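(* For any continuous tensor function $\mathsf{X} \in C([0,1]^N)$ and any $\varepsilon > 0$, there exist a fully connected neural network $\mathsf{G} \colon [0,1]^N \to \mathbb{R}$ and $N$ DeepONets $F_n \colon C([0,1]) \to C([0,1])$, $n = 1, 2, \dots, N$, such that $$\bigl\| \mathsf{X} - \mathscr{F}_N^{\langle N \rangle} \circ \cdots \circ \mathscr{F}_2^{\langle 2 \rangle} \circ \mathscr{F}_1^{\langle 1 \rangle} (\mathsf{G}) \bigr\| < \varepsilon,$$ where $\mathscr{F}_n^{\langle n \rangle}$ is the continuous and nonlinear mode-$n$ operator induced by $F_n$.
   Context: $N$ is a positive integer. $C([0,1]^N)$ denotes the space of real-valued continuous functions on $[0,1]^N$, whose elements are called ($N$th-order) continuous tensor functions, and $\|\mathsf{X}\| = \sup_{y\in[0,1]^N}|\mathsf{X}(y)|$ is the supremum norm. **Mode-$n$ operator.** Given a continuous operator $F \colon C([0,1]) \to C([0,1])$ (not necessarily linear) and $n \in \{1,\dots,N\}$, the continuous and nonlinear mode-$n$ operator induced by $F$ is the map $\mathscr{F}^{\langle n \rangle} \colon C([0,1]^N) \to C([0,1]^N)$ defined by $$\mathscr{F}^{\langle n \rangle}(\mathsf{G})(y_1, \dots, y_N) = F\bigl(\mathsf{G}(y_1, \dots, y_{n-1}, \,\cdot\,, y_{n+1}, \dots, y_N)\bigr)(y_n),$$ where $\mathsf{G}(y_1, \dots, y_{n-1}, \,\cdot\,, y_{n+1}, \dots, y_N) \in C([0,1])$ is the univariate function obtained from $\mathsf{G}$ by fixing all variables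 except the $n$th. **Fully connected neural network.** This has its usual meaning: a function obtained by alternately composing affine maps between finite-dimensional real spaces with the coordinatewise application of an activation function. The theorem does not prescribe a particular activation function, depth or width. **DeepONet.** A DeepONet (deep operator network) is an operator $F \colon C([0,1]) \to C([0,1])$ of the form $$F(v)(y) = \sum_{p=1}^{P} b_p\bigl(v(z_1), v(z_2), \dots, v(z_m)\bigr)\, t_p(y), \qquad v \in C([0,1]),\ y \in [0,1],$$ where $m, P$ are positive integers, $z_1, \dots, z_m \in [0,1]$ are fixed points (called sensors), $b_1,\dots,b_P \colon \mathbb{R}^m \to \mathbb{R}$ are continuous scalar-valued functions implemented by neural networks (called branch networks), and $t_1,\dots,t_P \colon [0,1]\to\mathbb{R}$ are the continuous components of a vector-valued function implemented by a neural network (called the trunk network). The architecture of these networks is not prescribed. The integers $m, P$, the sensors and the networks may depend on $n$. *)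

theory Defs
  imports "HOL-Analysis.Analysis"
begin

text \<open>A point of $\mathbb{R}^d$ is a function of type \<^typ>\<open>nat \<Rightarrow> real\<close> in the extensional
  product over \<open>{1..d}\<close>. On such functions the product topology of \<^typ>\<open>nat \<Rightarrow> real\<close> is the usual
  topology of $\mathbb{R}^d$, so \<^const>\<open>continuous_on\<close> has its ordinary meaning.\<close>

definition cube :: "nat \<Rightarrow> (nat \<Rightarrow> real) set" where
  "cube N = ({1..N} \<rightarrow>\<^sub>E {0..1})"

text \<open>The space $C(K)$. Its elements are extensional, so that each continuous function on \<open>K\<close> is
  represented exactly once and an operator cannot depend on values outside \<open>K\<close>.\<close>

definition cfun :: "'a::topological_space set \<Rightarrow> ('a \<Rightarrow> real) set" where
  "cfun K = {f \<in> extensional K. continuous_on K f}"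

definition sup_norm :: "'a set \<Rightarrow> ('a \<Rightarrow> real) \<Rightarrow> real" where
  "sup_norm K f = (SUP x\<in>K. \<bar>f x\<bar>)"

definition mode_op ::
  "nat \<Rightarrow> nat \<Rightarrow> ((real \<Rightarrow> real) \<Rightarrow> real \<Rightarrow> real) \<Rightarrow> ((nat \<Rightarrow> real) \<Rightarrow> real) \<Rightarrow> (nat \<Rightarrow> real) \<Rightarrow> real"
  where
  "mode_op N n F G = (\<lambda>y\<in>cube N. F (\<lambda>s\<in>{0..1}. G (y(n := s))) (y n))"

definition affine_layer :: "nat \<Rightarrow> nat \<Rightarrow> ((nat \<Rightarrow> real) \<Rightarrow> nat \<Rightarrow> real) \<Rightarrow> bool" where
  "affine_layer d e A \<longleftrightarrow>
     (\<exists>W b. A = (\<lambda>x. \<lambda>i\<in>{1..e}. (\<Sum>j=1..d. W i j * x j) + b i))"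

definition activate :: "(real \<Rightarrow> real) \<Rightarrow> nat \<Rightarrow> (nat \<Rightarrow> real) \<Rightarrow> nat \<Rightarrow> real" where
  "activate \<sigma> e x = (\<lambda>i\<in>{1..e}. \<sigma> (x i))"

text \<open>Fully connected networks from $\mathbb{R}^d$ to $\mathbb{R}^k$ with activation \<open>\<sigma>\<close>, of any
  depth and any positive widths, with at least one hidden layer and an affine output layer.\<close>

inductive fcnn :: "(real \<Rightarrow> real) \<Rightarrow> nat \<Rightarrow> nat \<Rightarrow> ((nat \<Rightarrow> real) \<Rightarrow> nat \<Rightarrow> real) \<Rightarrow> bool"
  for \<sigma> where
  shallow: "0 < e \<Longrightarrow> affine_layer d e A \<Longrightarrow> affine_layer e k A' \<Longrightarrow>
    fcnn \<sigma> d k (A' \<circ> activate \<sigma> e \<circ> A)"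
| deeper: "0 < e \<Longrightarrow> fcnn \<sigma> d e f \<Longrightarrow> affine_layer e k A \<Longrightarrow>
    fcnn \<sigma> d k (A \<circ> activate \<sigma> e \<circ> f)"

definition scalar_fcnn ::
  "(real \<Rightarrow> real) \<Rightarrow> nat \<Rightarrow> (nat \<Rightarrow> real) set \<Rightarrow> ((nat \<Rightarrow> real) \<Rightarrow> real) \<Rightarrow> bool" where
  "scalar_fcnn \<sigma> d K g \<longleftrightarrow> (\<exists>f. fcnn \<sigma> d 1 f \<and> g = (\<lambda>x\<in>K. f x 1))"

text \<open>The sensors are \<open>z 1, \<dots>, z m\<close>, the branch networks \<open>b 1, \<dots>, b P\<close>, and \<open>t 1, \<dots>, t P\<close> are
  the components of the single vector-valued trunk network \<open>T\<close>.\<close>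

definition deeponet :: "(real \<Rightarrow> real) \<Rightarrow> ((real \<Rightarrow> real) \<Rightarrow> real \<Rightarrow> real) \<Rightarrow> bool" where
  "deeponet \<sigma> F \<longleftrightarrow>
     (\<exists>m P z b T t. 0 < m \<and> 0 < P \<and> (\<forall>i\<in>{1..m}. z i \<in> {0..1}) \<and>
        (\<forall>p\<in>{1..P}. scalar_fcnn \<sigma> m ({1..m} \<rightarrow>\<^sub>E UNIV) (b p) \<and> b p \<in> cfun ({1..m} \<rightarrow>\<^sub>E UNIV)) \<and>
        fcnn \<sigma> 1 P T \<and>
        (\<forall>p\<in>{1..P}. t p = (\<lambda>y\<in>{0..1}. T (\<lambda>i\<in>{1..1}. y) p) \<and> t p \<in> cfun {0..1}) \<and>
        (\<forall>v\<in>cfun {0..1}.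
           F v = (\<lambda>y\<in>{0..1}. \<Sum>p=1..P. b p (\<lambda>i\<in>{1..m}. v (z i)) * t p y)))"

lemma restrict_cfun: "continuous_on K f \<Longrightarrow> restrict f K \<in> cfun K"
  unfolding cfun_def by (auto intro: continuous_on_eq)

lemma deeponet_cfun:
  assumes "deeponet \<sigma> F"
  shows "F \<in> cfun {0..1} \<rightarrow> cfun {0..1}"
proof
  fix v :: "real \<Rightarrow> real" assume v: "v \<in> cfun {0..1}"
  from assms obtain m P z b t where
    "\<forall>i\<in>{1..m::nat}. z i \<in> {0..1}" and
    "\<forall>p\<in>{1..P::nat}. b p \<in> cfun ({1..m} \<rightarrow>\<^sub>E UNIV)" and
    t: "\<forall>p\<in>{1..P}. t p \<in> cfun {0..1}" and
    F: "\<forall>v\<in>cfun {0..1}.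
           F v = (\<lambda>y\<in>{0..1}. \<Sum>p=1..P. b p (\<lambda>i\<in>{1..m}. v (z i)) * t p y)"
    unfolding deeponet_def ball_conj_distrib by (elim exE conjE) (rule that; assumption)
  have "continuous_on {0..1} (\<lambda>y. \<Sum>p=1..(P::nat). b p (\<lambda>i\<in>{1..m::nat}. v (z i)) * t p y)"
    using t by (intro continuous_intros) (auto simp: cfun_def)
  then show "F v \<in> cfun {0..1}"
    by (subst bspec[OF F v]) (rule restrict_cfun)
qed

lemma fun_upd_cube:
  assumes "y \<in> cube N" "n \<in> {1..N}" "s \<in> {0..1}"
  shows "y(n := s) \<in> cube N"
  using assms by (auto simp: cube_def PiE_iff extensional_def)

lemma mode_op_cfun:
  assumes F: "deeponet \<sigma> F" and G: "G \<in> cfun (cube N)" and n: "n \<in> {1..N}"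
  shows "mode_op N n F G \<in> cfun (cube N)"
proof -
  obtain m P z b t where
    z: "\<forall>i\<in>{1..m::nat}. z i \<in> {0..1}" and
    b: "\<forall>p\<in>{1..P}. b p \<in> cfun ({1..m} \<rightarrow>\<^sub>E UNIV)" and
    t: "\<forall>p\<in>{1..P::nat}. t p \<in> cfun {0..1}" and
    F': "\<forall>v\<in>cfun {0..1}.
           F v = (\<lambda>y\<in>{0..1}. \<Sum>p=1..P. b p (\<lambda>i\<in>{1..m}. v (z i)) * t p y)"
    using F unfolding deeponet_def ball_conj_distrib by (elim exE conjE) (rule that; assumption)
  have Gc: "continuous_on (cube N) G"
    using G by (simp add: cfun_def)
  have yn: "y n \<in> {0..1}" if "y \<in> cube N" for y
    using that n by (auto simp: cube_def)
  have slice: "(\<lambda>s\<in>{0..1}. G (y(n := s))) \<in> cfun {0..1}" if y: "y \<in> cube N" for y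
  proof -
    have "continuous_on {0..1} (\<lambda>s. y(n := s))"
      by (rule continuous_on_coordinatewise_then_product, rename_tac i, case_tac "i = n") auto
    then have "continuous_on {0..1} (\<lambda>s. G (y(n := s)))"
      by (rule continuous_on_compose2[OF Gc]) (use fun_upd_cube[OF y n] in blast)
    then show ?thesis
      by (rule restrict_cfun)
  qed
  have eval: "continuous_on (cube N) (\<lambda>y. G (y(n := s)))" if s: "s \<in> {0..1}" for s
  proof (rule continuous_on_compose2[OF Gc])
    show "continuous_on (cube N) (\<lambda>y. y(n := s))"
    proof (rule continuous_on_coordinatewise_then_product)
      fix i show "continuous_on (cube N) (\<lambda>y. (y(n := s)) i)"
        by (cases "i = n") (auto intro!: continuous_intros continuous_on_product_coordinates
              continuous_on_subset[OF continuous_on_product_coordinates])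
    qed
  qed (use fun_upd_cube[OF _ n s] in blast)
  have sens: "continuous_on (cube N) (\<lambda>y. \<lambda>i\<in>{1..m}. G (y(n := z i)))"
  proof (rule continuous_on_coordinatewise_then_product)
    fix i show "continuous_on (cube N) (\<lambda>y. (\<lambda>i\<in>{1..m}. G (y(n := z i))) i)"
      using eval z by (cases "i \<in> {1..m}") auto
  qed
  have eq: "mode_op N n F G y =
      (\<Sum>p=1..P. b p (\<lambda>i\<in>{1..m}. G (y(n := z i))) * t p (y n))" if y: "y \<in> cube N" for y
  proof -
    have "(\<lambda>i\<in>{1..m}. (\<lambda>s\<in>{0..1}. G (y(n := s))) (z i)) = (\<lambda>i\<in>{1..m}. G (y(n := z i)))"
      using z by (intro restrict_ext) simp
    then show ?thesis
      using bspec[OF F' slice[OF y]] yn[OF y] y by (simp add: mode_op_def)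
  qed
  have "continuous_on (cube N)
      (\<lambda>y. \<Sum>p=1..P. b p (\<lambda>i\<in>{1..m}. G (y(n := z i))) * t p (y n))"
  proof (intro continuous_on_sum continuous_on_mult)
    fix p assume p: "p \<in> {1..P}"
    have bc: "continuous_on ({1..m} \<rightarrow>\<^sub>E UNIV) (b p)" and tc: "continuous_on {0..1} (t p)"
      using b t p by (auto simp: cfun_def)
    show "continuous_on (cube N) (\<lambda>y. b p (\<lambda>i\<in>{1..m}. G (y(n := z i))))"
      by (rule continuous_on_compose2[OF bc sens]) auto
    show "continuous_on (cube N) (\<lambda>y. t p (y n))"
      by (rule continuous_on_compose2[OF tc continuous_on_subset[OF continuous_on_product_coordinates]])
         (use yn in auto)
  qed
  then have "continuous_on (cube N) (mode_op N n F G)"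
    using eq by (simp cong: continuous_on_cong)
  then show ?thesis
    by (simp add: cfun_def mode_op_def)
qed

end

theory Submission
  imports Defs
begin

text \<open>All the operators are chosen as approximate identities on the slices of the fixed target \<open>X\<close>. For
  a single mode, interpolate slices with a fine partition of unity of the interval; since the slices of
  \<open>X\<close> are uniformly bounded and equicontinuous, replacing sensor values and partition functions by
  networks gives a DeepONet that maps everything close enough to \<open>X\<close> to something within a prescribed
  distance of \<open>X\<close>. Choosing the tolerances backwards from mode \<open>N\<close> to mode \<open>1\<close> reduces the theorem
  to approximating \<open>X\<close> itself by a network.

  Universal approximation must cover polynomial activations, where depth is essential. Averaging a
  continuous non-affine activation twice over an interval gives a twice differentiable function whose second
  derivative is a second difference of the activation, hence nonzero somewhere; rescaled symmetric
  differences at such a point converge to the square function. Squares give products at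
  the cost of one more layer, and Stone-Weierstrass applies.\<close>

subsection \<open>Affine spans and uniform closures\<close>

text \<open>Generators are added one scaled copy at a time, so that induction peels off a single
  neuron; the free constant plays the part of the bias.\<close>

inductive_set aff_span :: "('a \<Rightarrow> real) set \<Rightarrow> ('a \<Rightarrow> real) set" for B where
  const: "(\<lambda>_. c) \<in> aff_span B"
| add_scaled: "f \<in> aff_span B \<Longrightarrow> g \<in> B \<Longrightarrow> (\<lambda>x. f x + c * g x) \<in> aff_span B"

lemma aff_span_base: "g \<in> B \<Longrightarrow> g \<in> aff_span B"
  using aff_span.add_scaled[OF aff_span.const[of 0 B], of g 1] by simp

lemma aff_span_lincomb:
  assumes "f \<in> aff_span B" "g \<in> aff_span B"
  shows "(\<lambda>x. f x + a * g x) \<in> aff_span B"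
  using assms(2)
proof induction
  case (const c)
  show ?case using assms(1)
  proof induction
    case (const d)
    show ?case using aff_span.const[of "d + a * c" B] by simp
  next
    case (add_scaled f g b)
    show ?case using aff_span.add_scaled[OF add_scaled.IH add_scaled.hyps(2), of b]
      by (simp add: algebra_simps)
  qed
next
  case (add_scaled h g c)
  show ?case using aff_span.add_scaled[OF add_scaled.IH add_scaled.hyps(2), of "a * c"]
    by (simp add: algebra_simps)
qed

lemma aff_span_affine: "g \<in> aff_span B \<Longrightarrow> (\<lambda>x. a * g x + b) \<in> aff_span B"
  using aff_span_lincomb[OF aff_span.const[of b B]] by (simp add: add.commute)

text \<open>Used to read off the hidden units of a layer. A generator that occurs again has its
  coefficient increased, so a finite set suffices in place of a list.\<close>

lemma aff_span_finite_basis: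
  assumes "f \<in> aff_span B"
  shows "\<exists>A c b. finite A \<and> A \<subseteq> B \<and> f = (\<lambda>x. (\<Sum>g\<in>A. c g * g x) + b)"
  using assms
proof induction
  case (const c)
  show ?case by (rule exI[of _ "{}"]) auto
next
  case (add_scaled f g a)
  from add_scaled.IH obtain A c b where A: "finite A" "A \<subseteq> B"
    and f: "f = (\<lambda>x. (\<Sum>g\<in>A. c g * g x) + b)" by blast
  show ?case
  proof (cases "g \<in> A")
    case True
    have "(\<Sum>k\<in>A. (c(g := c g + a)) k * k x) = (\<Sum>k\<in>A. c k * k x) + a * g x" for x
      using A True by (simp add: sum.remove[of A g] algebra_simps)
    then have "(\<lambda>x. f x + a * g x) = (\<lambda>x. (\<Sum>k\<in>A. (c(g := c g + a)) k * k x) + b)"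
      by (simp add: f fun_eq_iff)
    then show ?thesis using A by blast
  next
    case False
    have *: "(\<Sum>k\<in>A. (c(g := a)) k * k x) = (\<Sum>k\<in>A. c k * k x)" for x
      using False by (intro sum.cong) auto
    have "(\<lambda>x. f x + a * g x) = (\<lambda>x. (\<Sum>k\<in>insert g A. (c(g := a)) k * k x) + b)"
      unfolding fun_eq_iff f using A False * by (simp add: algebra_simps)
    moreover have "finite (insert g A)" "insert g A \<subseteq> B" using A add_scaled.hyps by auto
    ultimately show ?thesis by blast
  qed
qed

section \<open>Closure under uniform limits on a set\<close>

definition unif_closure :: "'a set \<Rightarrow> ('a \<Rightarrow> real) set \<Rightarrow> ('a \<Rightarrow> real) set" where
  "unif_closure K A = {f. \<forall>e>0. \<exists>g\<in>A. \<forall>x\<in>K. \<bar>f x - g x\<bar> < e}"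

lemma unif_closureD:
  assumes "f \<in> unif_closure K A" "e > 0"
  obtains g where "g \<in> A" "\<And>x. x \<in> K \<Longrightarrow> \<bar>f x - g x\<bar> < e"
  using assms unfolding unif_closure_def by blast

lemma unif_closure_subset: "A \<subseteq> unif_closure K A"
  unfolding unif_closure_def by force

text \<open>The closure is idempotent, by splitting \<open>e\<close> in halves. Later limits, of
  Riemann sums and of difference quotients, can thus be taken among functions that are themselves
  only approximable.\<close>

lemma unif_closure_limit:
  assumes "\<And>e. e > 0 \<Longrightarrow> \<exists>g\<in>unif_closure K A. \<forall>x\<in>K. \<bar>f x - g x\<bar> < e"
  shows "f \<in> unif_closure K A"
  unfolding unif_closure_def
proof (intro CollectI allI impI)
  fix e :: real assume "e > 0"
  then obtain g where g: "g \<in> unif_closure K A" "\<And>x. x \<in> K \<Longrightarrow> \<bar>f x - g x\<bar> < e/2"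
    using assms[of "e/2"] by auto
  obtain h where h: "h \<in> A" "\<And>x. x \<in> K \<Longrightarrow> \<bar>g x - h x\<bar> < e/2"
    using unif_closureD[OF g(1), of "e/2"] \<open>e > 0\<close> by auto
  have "\<bar>f x - h x\<bar> < e" if "x \<in> K" for x
    using g(2)[OF that] h(2)[OF that] by linarith
  with h(1) show "\<exists>g\<in>A. \<forall>x\<in>K. \<bar>f x - g x\<bar> < e" by blast
qed

lemma unif_closure_lincomb:
  assumes "f \<in> unif_closure K (aff_span B)" "g \<in> unif_closure K (aff_span B)"
  shows "(\<lambda>x. f x + a * g x) \<in> unif_closure K (aff_span B)"
  unfolding unif_closure_def
proof (intro CollectI allI impI)
  fix e :: real assume "e > 0"
  \<comment> \<open>The added 1 keeps the denominator positive when \<open>a = 0\<close>.\<close>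
  define e' where "e' = e / (2 * (\<bar>a\<bar> + 1))"
  have e': "e' > 0" "\<bar>a\<bar> * e' \<le> e/2" unfolding e'_def using \<open>e > 0\<close> by (auto simp: field_simps)
  obtain f' where f': "f' \<in> aff_span B" "\<And>x. x \<in> K \<Longrightarrow> \<bar>f x - f' x\<bar> < e/2"
    using unif_closureD[OF assms(1), of "e/2"] \<open>e > 0\<close> by auto
  obtain g' where g': "g' \<in> aff_span B" "\<And>x. x \<in> K \<Longrightarrow> \<bar>g x - g' x\<bar> < e'"
    using unif_closureD[OF assms(2) e'(1)] by auto
  have "\<bar>(f x + a * g x) - (f' x + a * g' x)\<bar> < e" if "x \<in> K" for x
  proof -
    have "\<bar>a * (g x - g' x)\<bar> \<le> \<bar>a\<bar> * e'"
      unfolding abs_mult using g'(2)[OF that] by (intro mult_left_mono) auto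
    then have "\<bar>a * g x - a * g' x\<bar> \<le> e/2" using e'(2) by (simp add: right_diff_distrib)
    then show ?thesis using f'(2)[OF that] by linarith
  qed
  then show "\<exists>h\<in>aff_span B. \<forall>x\<in>K. \<bar>f x + a * g x - h x\<bar> < e"
    using aff_span_lincomb[OF f'(1) g'(1), of a]
    by (intro bexI[of _ "\<lambda>x. f' x + a * g' x"]) auto
qed

lemma unif_closure_const: "(\<lambda>_. c) \<in> unif_closure K (aff_span B)"
  using aff_span.const unif_closure_subset by blast

lemma unif_closure_scale: "g \<in> unif_closure K (aff_span B) \<Longrightarrow> (\<lambda>x. a * g x) \<in> unif_closure K (aff_span B)"
  using unif_closure_lincomb[OF unif_closure_const[of 0]] by simp

lemma unif_closure_sum:
  "(\<And>k. k < n \<Longrightarrow> f k \<in> unif_closure K (aff_span B)) \<Longrightarrow>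
    (\<lambda>x. \<Sum>k<n. f k x) \<in> unif_closure K (aff_span B)" for n :: nat
proof (induction n)
  case (Suc n)
  then show ?case using unif_closure_lincomb[of "\<lambda>x. \<Sum>k<n. f k x" K B "f n" 1] by simp
qed (simp add: unif_closure_const)

subsection \<open>Approximating the square function\<close>

definition neurons :: "(real \<Rightarrow> real) \<Rightarrow> (real \<Rightarrow> real) set" where
  "neurons \<sigma> = {\<lambda>t. \<sigma> (w * t + b) |w b. True}"

text \<open>The closure of the span of one-variable neurons for uniform convergence on bounded
  intervals.\<close>

definition locally_approximable :: "(real \<Rightarrow> real) \<Rightarrow> (real \<Rightarrow> real) \<Rightarrow> bool" where
  "locally_approximable \<sigma> f \<longleftrightarrow> (\<forall>R. f \<in> unif_closure {-R..R} (aff_span (neurons \<sigma>)))"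

lemma aff_span_neurons_affine:
  assumes "f \<in> aff_span (neurons \<sigma>)"
  shows "(\<lambda>t. f (a * t + c)) \<in> aff_span (neurons \<sigma>)"
  using assms
proof induction
  case (add_scaled f g d)
  from add_scaled.hyps obtain w b where g: "g = (\<lambda>t. \<sigma> (w * t + b))"
    by (auto simp: neurons_def)
  have "(\<lambda>t. g (a * t + c)) = (\<lambda>t. \<sigma> ((w * a) * t + (w * c + b)))"
    by (simp add: g algebra_simps)
  then have "(\<lambda>t. g (a * t + c)) \<in> neurons \<sigma>"
    unfolding neurons_def by blast
  from aff_span.add_scaled[OF add_scaled.IH this] show ?case .
qed (rule aff_span.const)

text \<open>An affine substitution turns neurons into neurons but stretches the interval; having
  approximation at every radius pays for that.\<close>

lemma locally_approximable_affine:
  assumes "locally_approximable \<sigma> f"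
  shows "locally_approximable \<sigma> (\<lambda>t. f (a * t + c))"
  unfolding locally_approximable_def unif_closure_def
proof (intro CollectI allI impI)
  fix R e :: real assume "e > 0"
  define S where "S = \<bar>a\<bar> * R + \<bar>c\<bar>"
  obtain g where g: "g \<in> aff_span (neurons \<sigma>)" "\<And>x. x \<in> {-S..S} \<Longrightarrow> \<bar>f x - g x\<bar> < e"
    using unif_closureD[OF assms[unfolded locally_approximable_def, rule_format, of S] \<open>e > 0\<close>] by auto
  have "a * t + c \<in> {-S..S}" if "t \<in> {-R..R}" for t
  proof -
    have "\<bar>a * t\<bar> \<le> \<bar>a\<bar> * R" unfolding abs_mult using that by (intro mult_left_mono) auto
    then show ?thesis unfolding S_def by auto
  qed
  then show "\<exists>g\<in>aff_span (neurons \<sigma>). \<forall>x\<in>{-R..R}. \<bar>f (a * x + c) - g x\<bar> < e"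
    using aff_span_neurons_affine[OF g(1), of a c] g(2)
    by (intro bexI[of _ "\<lambda>t. g (a * t + c)"]) auto
qed

lemma locally_approximable_lincomb:
  "locally_approximable \<sigma> f \<Longrightarrow> locally_approximable \<sigma> g \<Longrightarrow>
    locally_approximable \<sigma> (\<lambda>x. f x + a * g x)"
  unfolding locally_approximable_def by (simp add: unif_closure_lincomb)

lemma locally_approximable_const: "locally_approximable \<sigma> (\<lambda>_. c)"
  unfolding locally_approximable_def by (simp add: unif_closure_const)

lemma locally_approximable_scale:
  "locally_approximable \<sigma> f \<Longrightarrow> locally_approximable \<sigma> (\<lambda>x. a * f x)"
  unfolding locally_approximable_def by (simp add: unif_closure_scale)

lemma locally_approximable_self: "locally_approximable \<sigma> \<sigma>"
proof -
  have "\<sigma> = (\<lambda>t. \<sigma> (1 * t + 0))" by simp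
  then have "\<sigma> \<in> neurons \<sigma>" unfolding neurons_def by blast
  then show ?thesis
    unfolding locally_approximable_def using unif_closure_subset aff_span_base by blast
qed

text \<open>The Riemann sums of the average are linear combinations of translates of \<open>f\<close>.\<close>
lemma locally_approximable_moving_average:
  assumes f: "locally_approximable \<sigma> f" "continuous_on UNIV f"
    and F: "\<And>x. (F has_real_derivative f x) (at x)" and h: "h > 0"
  shows "locally_approximable \<sigma> (\<lambda>x. F (x + h) - F x)"
  unfolding locally_approximable_def
proof (intro allI unif_closure_limit)
  fix R e :: real assume e: "e > 0"
  \<comment> \<open>Each of the \<open>n\<close> pieces of length \<open>h / n\<close> contributes
    at most \<open>h / n * e'\<close>, so the total error is \<open>e / 2\<close>.\<close>
  define e' where "e' = e / (2 * h)"
  have e': "e' > 0" "h * e' < e" using e h by (auto simp: e'_def field_simps)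
  have "uniformly_continuous_on {-R..R+h} f"
    by (intro compact_uniformly_continuous continuous_on_subset[OF f(2)]) auto
  then obtain d where d: "d > 0"
    "\<And>x y. x \<in> {-R..R+h} \<Longrightarrow> y \<in> {-R..R+h} \<Longrightarrow> \<bar>y - x\<bar> < d \<Longrightarrow> \<bar>f y - f x\<bar> < e'"
    unfolding uniformly_continuous_on_def dist_real_def using e'(1) by metis
  obtain n where n: "h / d < real n" using reals_Archimedean2 by blast
  define q where "q = h / n"
  have n0: "real n > 0" using n h d(1) by (meson divide_pos_pos order_less_trans)
  have q: "0 < q" "q < d" using n h d(1) n0 by (auto simp: q_def field_simps)
  \<comment> \<open>The left Riemann sum of \<open>f\<close> over an interval of length
    \<open>h\<close> starting at \<open>x\<close>; the mesh \<open>q\<close> lies below the modulus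
    of continuity \<open>d\<close>.\<close>
  define s where "s = (\<lambda>x. \<Sum>k<n. q * f (1 * x + k * q))"
  have "s \<in> unif_closure {-R..R} (aff_span (neurons \<sigma>))"
    unfolding s_def
  proof (rule unif_closure_sum)
    fix k
    show "(\<lambda>x. q * f (1 * x + real k * q)) \<in> unif_closure {-R..R} (aff_span (neurons \<sigma>))"
      using locally_approximable_scale[OF locally_approximable_affine[OF f(1), of 1 "k * q"], of q]
      unfolding locally_approximable_def by (rule spec)
  qed
  moreover have "\<bar>F (x + h) - F x - s x\<bar> < e" if x: "x \<in> {-R..R}" for x
  proof -
    have tel: "(\<Sum>k<m. F (x + Suc k * q) - F (x + k * q)) = F (x + m * q) - F x" for m
      using sum_lessThan_telescope[of "\<lambda>k. F (x + k * q)" m] by simp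
    have "n * q = h" using n0 by (simp add: q_def)
    then have "F (x + h) - F x - s x
        = (\<Sum>k<n. F (x + Suc k * q) - F (x + k * q) - q * f (x + k * q))"
      using tel[of n] by (simp add: s_def sum_subtractf)
    then have "\<bar>F (x + h) - F x - s x\<bar>
        \<le> (\<Sum>k<n. \<bar>F (x + Suc k * q) - F (x + k * q) - q * f (x + k * q)\<bar>)"
      by (simp only: sum_abs)
    also have "\<dots> \<le> (\<Sum>k<n. q * e')"
    proof (rule sum_mono)
      fix k assume k: "k \<in> {..<n}"
      \<comment> \<open>By the mean value theorem the increment of \<open>F\<close> over one piece
        is \<open>q * f z\<close> with \<open>z\<close> within \<open>q < d\<close> of the left end,
        where \<open>f\<close> has changed by less than \<open>e'\<close>.\<close>
      have lt: "x + k * q < x + Suc k * q"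
        by (intro add_strict_left_mono mult_strict_right_mono) (use q in auto)
      have "\<exists>z>x + k * q. z < x + Suc k * q \<and>
          F (x + Suc k * q) - F (x + k * q) = (x + Suc k * q - (x + k * q)) * f z"
        by (rule MVT2[OF lt]) (rule F)
      then obtain z where z: "x + k * q < z" "z < x + Suc k * q"
        "F (x + Suc k * q) - F (x + k * q) = (x + Suc k * q - (x + k * q)) * f z"
        by blast
      have "Suc k * q \<le> n * q" using k q by (intro mult_right_mono) auto
      then have "x + Suc k * q \<le> R + h" using x \<open>n * q = h\<close> by simp
      moreover have "x + k * q \<ge> -R" using x q by (simp add: add_increasing2)
      moreover have "Suc k * q = k * q + q" by (simp add: algebra_simps)
      ultimately have "x + k * q \<in> {-R..R+h}" "z \<in> {-R..R+h}" "\<bar>z - (x + k * q)\<bar> < d"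
        using z(1,2) lt q by auto
      then have "\<bar>f z - f (x + k * q)\<bar> < e'" by (rule d(2))
      then have "q * \<bar>f z - f (x + k * q)\<bar> \<le> q * e'" using q by (intro mult_left_mono) auto
      moreover have "F (x + Suc k * q) - F (x + k * q) - q * f (x + k * q) = q * (f z - f (x + k * q))"
        unfolding z(3) by (simp add: algebra_simps)
      ultimately show "\<bar>F (x + Suc k * q) - F (x + k * q) - q * f (x + k * q)\<bar> \<le> q * e'"
        using q by (simp add: abs_mult)
    qed
    also have "\<dots> = h * e'" using \<open>n * q = h\<close> by (simp add: mult.assoc[symmetric])
    also have "\<dots> < e" by (rule e'(2))
    finally show ?thesis .
  qed
  ultimately show "\<exists>g\<in>unif_closure {-R..R} (aff_span (neurons \<sigma>)). \<forall>x\<in>{-R..R}. \<bar>F (x + h) - F x - g x\<bar> < e"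
    by blast
qed

section \<open>Antiderivatives and vanishing second differences\<close>

lemma real_antiderivative:
  fixes f :: "real \<Rightarrow> real"
  assumes "continuous_on UNIV f"
  shows "\<exists>F. \<forall>x. (F has_real_derivative f x) (at x)"
proof -
  have "\<exists>F. \<forall>x::real. -\<infinity> < ereal x \<longrightarrow> ereal x < \<infinity> \<longrightarrow> (F has_vector_derivative f x) (at x)"
    by (rule einterval_antiderivative) (use assms in \<open>auto simp: continuous_on_eq_continuous_at\<close>)
  then show ?thesis
    by (simp add: has_real_derivative_iff_has_vector_derivative)
qed

lemma DERIV_translate_diff:
  assumes "\<And>x. (F has_real_derivative f x) (at x)"
  shows "((\<lambda>x. F (x + h) - F x) has_real_derivative f (x + h) - f x) (at x)"
  using DERIV_diff[OF DERIV_shift[THEN iffD1, OF assms[of "x + h"]] assms[of x]] .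

text \<open>The function \<open>f - f 0\<close> is additive; it is differentiable because it differs by a constant from an
  increment of an antiderivative of \<open>f\<close>.\<close>
lemma second_difference_zero_imp_affine:
  fixes f :: "real \<Rightarrow> real"
  assumes cont: "continuous_on UNIV f"
    and zero: "\<And>x h. h > 0 \<Longrightarrow> f (x + 2*h) - 2 * f (x + h) + f x = 0"
  shows "\<exists>a c. \<forall>x. f x = a * x + c"
proof -
  obtain F where F: "\<And>x. (F has_real_derivative f x) (at x)"
    using real_antiderivative[OF cont] by blast
  have mid: "f x + f y = 2 * f ((x + y) / 2)" for x y
  proof -
    have *: "f x + f y = 2 * f ((x + y) / 2)" if "x < y" for x y
      using zero[of "(y - x) / 2" x] that by (simp add: field_simps)
    show ?thesis
      using *[of x y] *[of y x] by (cases x y rule: linorder_cases) (auto simp: add.commute)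
  qed
  define g where "g = (\<lambda>x. f x - f 0)"
  \<comment> \<open>The pairs \<open>x, t\<close> and \<open>x + t, 0\<close> have the same
    midpoint.\<close>
  have add: "f (x + t) - f t = g x" for x t
    using mid[of x t] mid[of "x + t" 0] by (simp add: g_def)
  \<comment> \<open>As a function of \<open>t\<close>, \<open>F (x + t) - F t\<close> has the
    constant derivative \<open>g x\<close>, hence is linear; its values at 1 and 0 are compared.
    This expresses \<open>g\<close> through the differentiable \<open>F\<close>.\<close>
  have F1: "F (x + 1) - F 1 = g x + F x - F 0" for x
  proof -
    have "((\<lambda>t. F (x + t) - F t - g x * t) has_real_derivative 0) (at t)" for t
    proof -
      have "((\<lambda>t. F (x + t)) has_real_derivative f (x + t)) (at t)"
        using F[of "x + t"] DERIV_shift[of F "f (x + t)" t x] by (simp add: add.commute)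
      from DERIV_diff[OF DERIV_diff[OF this F[of t]] DERIV_cmult_Id[of "g x"]]
      show ?thesis using add[of x t] by simp
    qed
    from DERIV_isconst_all[of "\<lambda>t. F (x + t) - F t - g x * t", rule_format, OF this, of 1 0]
    show ?thesis by simp
  qed
  have "((\<lambda>x. g x - g 1 * x) has_real_derivative 0) (at x)" for x
  proof -
    have "((\<lambda>x. F (x + 1)) has_real_derivative f (x + 1)) (at x)"
      using F[of "x + 1"] DERIV_shift[of F "f (x + 1)" x 1] by simp
    from DERIV_diff[OF DERIV_diff[OF this F[of x]] DERIV_cmult_Id[of "g 1"]]
    have "((\<lambda>x. F (x + 1) - F x - g 1 * x) has_real_derivative 0) (at x)"
      using add[of 1 x] by (simp add: add.commute)
    from DERIV_add[OF this DERIV_const[of "F 0 - F 1"]]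
    have "((\<lambda>x. F (x + 1) - F x - g 1 * x + (F 0 - F 1)) has_real_derivative 0) (at x)"
      by simp
    moreover have "(\<lambda>x. F (x + 1) - F x - g 1 * x + (F 0 - F 1)) = (\<lambda>x. g x - g 1 * x)"
    proof
      fix y show "F (y + 1) - F y - g 1 * y + (F 0 - F 1) = g y - g 1 * y"
        using F1[of y] by linarith
    qed
    ultimately show ?thesis by simp
  qed
  then have "g x - g 1 * x = g 0 - g 1 * 0" for x
    using DERIV_isconst_all[of "\<lambda>x. g x - g 1 * x"] by blast
  moreover have "g 0 = 0" by (simp add: g_def)
  ultimately have "g x = g 1 * x" for x by (metis diff_0_right eq_iff_diff_eq_0 mult_zero_right)
  then have "f x = g 1 * x + f 0" for x unfolding g_def by (metis diff_add_cancel)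
  then show ?thesis by blast
qed

text \<open>As a function of \<open>u\<close>, the error vanishes at 0 together with its first
  derivative, and its second derivative is at most \<open>2 * e\<close> in absolute value for
  \<open>\<bar>u\<bar> \<le> d\<close>. Taylor expansion with Lagrange remainder gives the
  bound.\<close>

lemma symmetric_difference_approx_square:
  fixes f f' D :: "real \<Rightarrow> real"
  assumes f: "\<And>x. (f has_real_derivative f' x) (at x)"
    and f': "\<And>x. (f' has_real_derivative D x) (at x)"
    and d: "\<And>s. \<bar>s\<bar> \<le> d \<Longrightarrow> \<bar>D (c + s) - D c\<bar> \<le> e" and u: "\<bar>u\<bar> \<le> d"
  shows "\<bar>f (c + u) + f (c - u) - 2 * f c - D c * u\<^sup>2\<bar> \<le> e * u\<^sup>2"
proof -
  \<comment> \<open>The error and its first two derivatives, indexed by order as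
    \<open>Maclaurin_bi_le\<close> expects.\<close>
  define G where "G = (\<lambda>m::nat. if m = 0 then \<lambda>u. f (c + u) + f (c - u) - 2 * f c - D c * u\<^sup>2
    else if m = 1 then \<lambda>u. f' (c + u) - f' (c - u) - 2 * D c * u
    else (\<lambda>u. D (c + u) + D (c - u) - 2 * D c))"
  have shift: "((\<lambda>u. g (c + u)) has_real_derivative g' (c + x)) (at x)"
    "((\<lambda>u. g (c - u)) has_real_derivative - g' (c - x)) (at x)"
    if "\<And>x. (g has_real_derivative g' x) (at x)" for g g' :: "real \<Rightarrow> real" and x
  proof -
    show "((\<lambda>u. g (c + u)) has_real_derivative g' (c + x)) (at x)"
      using DERIV_chain2[OF that, of "\<lambda>u. c + u" 1 x UNIV]
      by (simp add: DERIV_add[OF DERIV_const DERIV_ident, simplified])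
    show "((\<lambda>u. g (c - u)) has_real_derivative - g' (c - x)) (at x)"
      using DERIV_chain2[OF that, of "\<lambda>u. c - u" "-1" x UNIV]
      by (simp add: DERIV_diff[OF DERIV_const DERIV_ident, simplified])
  qed
  have D: "\<forall>m t. m < 2 \<and> \<bar>t\<bar> \<le> \<bar>u\<bar> \<longrightarrow> DERIV (G m) t :> G (Suc m) t"
  proof (intro allI impI)
    fix m :: nat and t assume "m < 2 \<and> \<bar>t\<bar> \<le> \<bar>u\<bar>"
    then consider "m = 0" | "m = 1" by linarith
    then show "DERIV (G m) t :> G (Suc m) t"
    proof cases
      case 1
      then show ?thesis
        by (auto simp: G_def intro!: derivative_eq_intros shift[OF f])
    next
      case 2
      then show ?thesis
        by (auto simp: G_def intro!: derivative_eq_intros shift[OF f'])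
    qed
  qed
  obtain t where t: "\<bar>t\<bar> \<le> \<bar>u\<bar>"
    "G 0 u = (\<Sum>m<2. G m 0 / fact m * u ^ m) + G 2 t / fact 2 * u ^ 2"
    using Maclaurin_bi_le[of G "G 0" 2 u, OF refl D] by blast
  have "(\<Sum>m<2. G m 0 / fact m * u ^ m) = 0"
    by (simp add: numeral_2_eq_2 G_def)
  then have G0: "G 0 u = G 2 t / 2 * u\<^sup>2" using t(2) by simp
  have "\<bar>G 2 t\<bar> \<le> 2 * e"
    using d[of t] d[of "-t"] t(1) u by (auto simp: G_def)
  then have "\<bar>G 2 t / 2\<bar> * u\<^sup>2 \<le> e * u\<^sup>2" by (intro mult_right_mono) auto
  moreover have "\<bar>G 0 u\<bar> = \<bar>G 2 t / 2\<bar> * u\<^sup>2" unfolding G0 by (simp add: abs_mult)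
  ultimately have "\<bar>G 0 u\<bar> \<le> e * u\<^sup>2" by linarith
  then show ?thesis unfolding G_def by simp
qed

lemma locally_approximable_square:
  assumes cont: "continuous_on UNIV \<sigma>" and nonaffine: "\<nexists>a c. \<forall>x. \<sigma> x = a * x + c"
  shows "locally_approximable \<sigma> (\<lambda>t. t\<^sup>2)"
proof -
  \<comment> \<open>A second difference that vanished everywhere would make \<open>\<sigma>\<close>
    affine. The value found here becomes the second derivative \<open>D c\<close> of the smoothed
    function \<open>f\<close>.\<close>
  obtain c h where h: "h > 0" and ch: "\<sigma> (c + 2*h) - 2 * \<sigma> (c + h) + \<sigma> c \<noteq> 0"
    using second_difference_zero_imp_affine[OF cont] nonaffine by blast
  obtain F1 where F1: "\<And>x. (F1 has_real_derivative \<sigma> x) (at x)"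
    using real_antiderivative[OF cont] by blast
  \<comment> \<open>\<open>h\<close> times the average of \<open>\<sigma>\<close> over
    \<open>{x..x+h}\<close>; \<open>f\<close> below repeats this with \<open>s1\<close>, giving two
    derivatives although \<open>\<sigma>\<close> is only continuous.\<close>
  define s1 where "s1 = (\<lambda>x. F1 (x + h) - F1 x)"
  have s1: "locally_approximable \<sigma> s1"
    unfolding s1_def by (rule locally_approximable_moving_average[OF locally_approximable_self cont F1 h])
  have s1': "(s1 has_real_derivative \<sigma> (x + h) - \<sigma> x) (at x)" for x
    unfolding s1_def by (rule DERIV_translate_diff[OF F1])
  have s1c: "continuous_on UNIV s1"
    by (rule DERIV_continuous_on[of UNIV s1 "\<lambda>x. \<sigma> (x + h) - \<sigma> x"]) (use s1' in simp)
  obtain F2 where F2: "\<And>x. (F2 has_real_derivative s1 x) (at x)"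
    using real_antiderivative[OF s1c] by blast
  define f where "f = (\<lambda>x. F2 (x + h) - F2 x)"
  have f: "locally_approximable \<sigma> f"
    unfolding f_def by (rule locally_approximable_moving_average[OF s1 s1c F2 h])
  define f' where "f' = (\<lambda>x. s1 (x + h) - s1 x)"
  define D where "D = (\<lambda>x. (\<sigma> (x + h + h) - \<sigma> (x + h)) - (\<sigma> (x + h) - \<sigma> x))"
  have f': "(f has_real_derivative f' x) (at x)" for x
    unfolding f_def f'_def by (rule DERIV_translate_diff[OF F2])
  have f'': "(f' has_real_derivative D x) (at x)" for x
    unfolding f'_def D_def by (rule DERIV_translate_diff[OF s1'])
  have Dc: "D c \<noteq> 0" using ch by (simp add: D_def algebra_simps)
  have "continuous_on UNIV D"
    unfolding D_def by (intro continuous_intros continuous_on_compose2[OF cont]) auto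
  then have Dcont: "isCont D c" by (simp add: continuous_on_eq_continuous_at)
  show ?thesis
    unfolding locally_approximable_def
  proof (intro allI unif_closure_limit)
    fix R e :: real assume e: "e > 0"
    define S where "S = \<bar>R\<bar> + 1"
    have S: "S > 0" "R \<le> S" by (auto simp: S_def)
    \<comment> \<open>Dividing the error by \<open>D c\<close> on an interval of radius
      \<open>S\<close> leaves exactly \<open>e / 2\<close>. The added 1 in \<open>S\<close> makes it
      positive for every \<open>R\<close>.\<close>
    define e1 where "e1 = e * \<bar>D c\<bar> / (2 * S\<^sup>2)"
    have e1: "e1 > 0" "e1 * S\<^sup>2 / \<bar>D c\<bar> < e" using e Dc S by (auto simp: e1_def field_simps)
    obtain d where d: "d > 0" "\<And>y. \<bar>y - c\<bar> < d \<Longrightarrow> \<bar>D y - D c\<bar> < e1"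
      using Dcont e1(1) unfolding continuous_at_eps_delta dist_real_def by metis
    \<comment> \<open>The scale that brings \<open>\<eta> * t\<close> within \<open>d / 2\<close> of
      0 for all \<open>t\<close> in the interval.\<close>
    define \<eta> where "\<eta> = d / (2 * S)"
    have \<eta>: "\<eta> > 0" "\<eta> * S = d / 2" using d S by (auto simp: \<eta>_def)
    \<comment> \<open>The symmetric second difference of \<open>f\<close> at \<open>c\<close> with
      step \<open>\<eta> * t\<close>, divided by its leading coefficient. The factors 1 match the
      shapes of the closure lemmas.\<close>
    define g where "g = (\<lambda>t. 1 / (\<eta>\<^sup>2 * D c) * ((f (\<eta> * t + c) + 1 * f ((-\<eta>) * t + c)) + (- 2 * f c) * 1))"
    have "locally_approximable \<sigma> g"
      unfolding g_def
      by (rule locally_approximable_scale[OF locally_approximable_lincomb[OF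
            locally_approximable_lincomb[OF locally_approximable_affine[OF f, of \<eta> c]
              locally_approximable_affine[OF f, of "-\<eta>" c], of 1]
            locally_approximable_const[of \<sigma> 1], of "-2 * f c"]])
    moreover have "\<bar>t\<^sup>2 - g t\<bar> < e" if t: "t \<in> {-R..R}" for t
    proof -
      have tS: "\<bar>t\<bar> \<le> S" using t S by auto
      have u: "\<bar>\<eta> * t\<bar> \<le> d/2"
        using mult_left_mono[OF tS, of \<eta>] \<eta> by (simp add: abs_mult)
      have "\<bar>f (c + \<eta> * t) + f (c - \<eta> * t) - 2 * f c - D c * (\<eta> * t)\<^sup>2\<bar> \<le> e1 * (\<eta> * t)\<^sup>2"
      proof (rule symmetric_difference_approx_square[OF f' f'' _ u])
        show "\<bar>D (c + s) - D c\<bar> \<le> e1" if "\<bar>s\<bar> \<le> d/2" for s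
          using d(2)[of "c + s"] that d(1) by auto
      qed
      moreover have "f (c + \<eta> * t) + f (c - \<eta> * t) - 2 * f c - D c * (\<eta> * t)\<^sup>2 = \<eta>\<^sup>2 * D c * (g t - t\<^sup>2)"
        using \<eta>(1) Dc by (simp add: g_def field_simps power_mult_distrib)
      ultimately have "\<eta>\<^sup>2 * (\<bar>D c\<bar> * \<bar>g t - t\<^sup>2\<bar>) \<le> \<eta>\<^sup>2 * (e1 * t\<^sup>2)"
        by (simp add: abs_mult power_mult_distrib mult_ac)
      then have "\<bar>D c\<bar> * \<bar>g t - t\<^sup>2\<bar> \<le> e1 * t\<^sup>2" using \<eta>(1) by simp
      also have "\<dots> \<le> e1 * S\<^sup>2"
        using tS e1(1) S by (intro mult_left_mono abs_le_square_iff[THEN iffD1]) auto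
      finally have "\<bar>g t - t\<^sup>2\<bar> \<le> e1 * S\<^sup>2 / \<bar>D c\<bar>" using Dc by (simp add: field_simps)
      with e1(2) show ?thesis by (simp add: abs_minus_commute)
    qed
    ultimately show "\<exists>g\<in>unif_closure {-R..R} (aff_span (neurons \<sigma>)). \<forall>x\<in>{-R..R}. \<bar>x\<^sup>2 - g x\<bar> < e"
      unfolding locally_approximable_def by blast
  qed
qed

text \<open>By polarization, \<open>t\<close> is a quarter of the difference of the squares of
  \<open>t + 1\<close> and \<open>t - 1\<close>. It serves to carry a value through a further hidden
  layer.\<close>

lemma locally_approximable_ident:
  assumes "continuous_on UNIV \<sigma>" "\<nexists>a c. \<forall>x. \<sigma> x = a * x + c"
  shows "locally_approximable \<sigma> (\<lambda>t. t)"
proof -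
  note sq = locally_approximable_affine[OF locally_approximable_square[OF assms]]
  have "locally_approximable \<sigma> (\<lambda>t. 1/4 * ((1 * t + 1)\<^sup>2 + (-1) * (1 * t + (-1))\<^sup>2))"
    by (rule locally_approximable_scale[OF locally_approximable_lincomb[OF sq[of 1 1] sq[of 1 "-1"], of "-1"]])
  moreover have "1/4 * ((1 * t + 1)\<^sup>2 + (-1) * (1 * t + (-1))\<^sup>2) = t" for t :: real
    by (simp add: power2_eq_square algebra_simps)
  ultimately show ?thesis by (simp only:)
qed

subsection \<open>Universal approximation\<close>

text \<open>The scalar networks with exactly \<open>L\<close> hidden layers, affine functions for \<open>L = 0\<close>. Fixing the
  depth makes them closed under linear combinations (run two networks in parallel), and
  the identity, being locally approximable, lets one raise the depth up to a small error.\<close>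
primrec nets :: "(real \<Rightarrow> real) \<Rightarrow> nat \<Rightarrow> nat \<Rightarrow> ((nat \<Rightarrow> real) \<Rightarrow> real) set" where
  "nets \<sigma> d 0 = aff_span ((\<lambda>j x. x j) ` {1..d})"
| "nets \<sigma> d (Suc L) = aff_span ((\<lambda>f x. \<sigma> (f x)) ` nets \<sigma> d L)"

lemma nets_eq_aff_span: "\<exists>B. nets \<sigma> d L = aff_span B"
  by (cases L) auto

lemma nets_affine:
  assumes "g \<in> nets \<sigma> d L"
  shows "(\<lambda>x. a * g x + b) \<in> nets \<sigma> d L"
  using nets_eq_aff_span[of \<sigma> d L] aff_span_affine assms by metis

lemma const_in_nets: "(\<lambda>_. c) \<in> nets \<sigma> d L"
  using nets_eq_aff_span[of \<sigma> d L] aff_span.const by metis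

lemma aff_span_continuous:
  assumes "f \<in> aff_span B" "\<And>g. g \<in> B \<Longrightarrow> continuous_on UNIV g"
  shows "continuous_on UNIV f"
  using assms(1)
proof induction
  case (add_scaled f g c)
  show ?case
    using add_scaled.IH assms(2)[OF add_scaled.hyps(2)]
    by (intro continuous_on_add continuous_on_mult continuous_on_const)
qed (rule continuous_on_const)

lemma nets_continuous:
  assumes "continuous_on UNIV \<sigma>" "f \<in> nets \<sigma> d L"
  shows "continuous_on UNIV f"
  using assms(2)
proof (induction L arbitrary: f)
  case 0
  then show ?case by (auto elim!: aff_span_continuous)
next
  case (Suc L)
  show ?case
  proof (rule aff_span_continuous)
    show "f \<in> aff_span ((\<lambda>f x. \<sigma> (f x)) ` nets \<sigma> d L)" using Suc.prems by simp
    fix g assume "g \<in> (\<lambda>f x. \<sigma> (f x)) ` nets \<sigma> d L"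
    then obtain h where h: "h \<in> nets \<sigma> d L" "g = (\<lambda>x. \<sigma> (h x))" by auto
    show "continuous_on UNIV g"
      unfolding h(2) by (rule continuous_on_compose2[OF assms(1) Suc.IH[OF h(1)]]) simp
  qed
qed

text \<open>The inner map \<open>w * t + b\<close> of each neuron is absorbed by the affine output
  of \<open>g\<close>, so exactly one hidden layer is added.\<close>

lemma nets_compose:
  assumes s: "s \<in> aff_span (neurons \<sigma>)" and g: "g \<in> nets \<sigma> d L"
  shows "(\<lambda>x. s (g x)) \<in> nets \<sigma> d (Suc L)"
  using s
proof induction
  case (const c)
  show ?case by (rule const_in_nets)
next
  case (add_scaled f n c)
  then obtain w b where n: "n = (\<lambda>t. \<sigma> (w * t + b))" by (auto simp: neurons_def)
  have "(\<lambda>x. n (g x)) \<in> (\<lambda>f x. \<sigma> (f x)) ` nets \<sigma> d L"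
    unfolding n using nets_affine[OF g] by (intro image_eqI[where x = "\<lambda>x. w * g x + b"]) auto
  from aff_span.add_scaled[OF _ this, of "\<lambda>x. f (g x)" c] add_scaled.IH show ?case by simp
qed

lemma unif_closure_nets_compose:
  fixes q :: "real \<Rightarrow> real"
  assumes q: "locally_approximable \<sigma> q" "continuous_on UNIV q"
    and f: "f \<in> unif_closure K (nets \<sigma> d L)" "\<forall>x\<in>K. \<bar>f x\<bar> \<le> M"
  shows "(\<lambda>x. q (f x)) \<in> unif_closure K (nets \<sigma> d (Suc L))"
  unfolding unif_closure_def
proof (intro CollectI allI impI)
  fix e :: real assume e: "e > 0"
  \<comment> \<open>The range of \<open>f\<close> enlarged by 1, so that a network within
    \<open>min \<delta> 1\<close> of \<open>f\<close> still has its values where \<open>s\<close>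
    approximates \<open>q\<close>.\<close>
  define I where "I = {-(M+1)..M+1}"
  have "uniformly_continuous_on I q"
    unfolding I_def by (intro compact_uniformly_continuous continuous_on_subset[OF q(2)]) auto
  then obtain \<delta> where \<delta>: "\<delta> > 0" "\<And>x y. x \<in> I \<Longrightarrow> y \<in> I \<Longrightarrow> \<bar>y - x\<bar> < \<delta> \<Longrightarrow> \<bar>q y - q x\<bar> < e/2"
    unfolding uniformly_continuous_on_def dist_real_def using e by (metis half_gt_zero)
  obtain s where s: "s \<in> aff_span (neurons \<sigma>)" "\<And>t. t \<in> I \<Longrightarrow> \<bar>q t - s t\<bar> < e/2"
    using unif_closureD[OF q(1)[unfolded locally_approximable_def, rule_format, of "M+1"], of "e/2"] e
    unfolding I_def by auto
  obtain g where g: "g \<in> nets \<sigma> d L" "\<And>x. x \<in> K \<Longrightarrow> \<bar>f x - g x\<bar> < min \<delta> 1"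
    using unif_closureD[OF f(1), of "min \<delta> 1"] \<delta>(1) by auto
  have "\<bar>q (f x) - s (g x)\<bar> < e" if x: "x \<in> K" for x
  proof -
    have I: "f x \<in> I" "g x \<in> I" using bspec[OF f(2) x] g(2)[OF x] by (auto simp: I_def)
    have "\<bar>q (f x) - q (g x)\<bar> < e/2" using g(2)[OF x] by (intro \<delta>(2) I) auto
    with s(2)[OF I(2)] show ?thesis by linarith
  qed
  then show "\<exists>h\<in>nets \<sigma> d (Suc L). \<forall>x\<in>K. \<bar>q (f x) - h x\<bar> < e"
    using nets_compose[OF s(1) g(1)] by (intro bexI[of _ "\<lambda>x. s (g x)"]) auto
qed

lemma unif_closure_nets_lincomb:
  assumes "f \<in> unif_closure K (nets \<sigma> d L)" "g \<in> unif_closure K (nets \<sigma> d L)"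
  shows "(\<lambda>x. f x + a * g x) \<in> unif_closure K (nets \<sigma> d L)"
proof -
  obtain B where "nets \<sigma> d L = aff_span B" using nets_eq_aff_span by blast
  with assms show ?thesis using unif_closure_lincomb[of f K B g a] by simp
qed

section \<open>Density of networks by Stone-Weierstrass\<close>

lemma compact_bounded_abs:
  fixes f :: "'a::topological_space \<Rightarrow> real"
  assumes "compact K" "continuous_on K f"
  shows "\<exists>M. \<forall>x\<in>K. \<bar>f x\<bar> \<le> M"
  using compact_imp_bounded[OF compact_continuous_image[OF assms(2,1)]]
  by (auto simp: bounded_iff)

locale nonaffine_activation =
  fixes \<sigma> :: "real \<Rightarrow> real"
  assumes cont: "continuous_on UNIV \<sigma>" and nonaffine: "\<nexists>a c. \<forall>x. \<sigma> x = a * x + c"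
begin

lemma unif_closure_nets_mono:
  assumes f: "f \<in> unif_closure K (nets \<sigma> d L)" "\<forall>x\<in>K. \<bar>f x\<bar> \<le> M" and "L \<le> L'"
  shows "f \<in> unif_closure K (nets \<sigma> d L')"
  using \<open>L \<le> L'\<close>
proof (induction rule: dec_induct)
  case base
  show ?case by (rule f(1))
next
  case (step n)
  then show ?case
    using unif_closure_nets_compose[OF locally_approximable_ident[OF cont nonaffine] _ step.IH f(2)]
    by (simp add: continuous_on_id)
qed

text \<open>Polarization again: both squares are approximable at depth \<open>Suc L\<close>, and so
  is a quarter of their difference.\<close>

lemma unif_closure_nets_mult:
  assumes f: "f \<in> unif_closure K (nets \<sigma> d L)" "\<forall>x\<in>K. \<bar>f x\<bar> \<le> M"
    and g: "g \<in> unif_closure K (nets \<sigma> d L)" "\<forall>x\<in>K. \<bar>g x\<bar> \<le> M'"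
  shows "(\<lambda>x. f x * g x) \<in> unif_closure K (nets \<sigma> d (Suc L))"
proof -
  have sq: "(\<lambda>x. (f x + a * g x)\<^sup>2) \<in> unif_closure K (nets \<sigma> d (Suc L))" if "\<bar>a\<bar> = 1" for a
  proof (rule unif_closure_nets_compose[OF locally_approximable_square[OF cont nonaffine]])
    show "continuous_on UNIV (\<lambda>t::real. t\<^sup>2)" by (intro continuous_intros)
    show "(\<lambda>x. f x + a * g x) \<in> unif_closure K (nets \<sigma> d L)" by (rule unif_closure_nets_lincomb[OF f(1) g(1)])
    show "\<forall>x\<in>K. \<bar>f x + a * g x\<bar> \<le> M + M'"
    proof
      fix x assume x: "x \<in> K"
      have "\<bar>a * g x\<bar> = \<bar>g x\<bar>" using that by (simp add: abs_mult)
      then show "\<bar>f x + a * g x\<bar> \<le> M + M'" using bspec[OF f(2) x] bspec[OF g(2) x] by linarith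
    qed
  qed
  have "(\<lambda>x. 0) \<in> unif_closure K (nets \<sigma> d (Suc L))" using const_in_nets unif_closure_subset by blast
  from unif_closure_nets_lincomb[OF this unif_closure_nets_lincomb[OF sq[of 1] sq[of "-1"], of "-1"], of "1/4"]
  have "(\<lambda>x. 0 + 1/4 * ((f x + 1 * g x)\<^sup>2 + (-1) * (f x + (-1) * g x)\<^sup>2)) \<in> unif_closure K (nets \<sigma> d (Suc L))"
    by simp
  moreover have "0 + 1/4 * ((u + 1 * v)\<^sup>2 + (-1) * (u + (-1) * v)\<^sup>2) = u * v" for u v :: real
    by (simp add: power2_eq_square algebra_simps)
  ultimately show ?thesis by (simp only:)
qed

text \<open>The conclusion holds for all large depths, so that several components can later share
  one depth.\<close>

lemma nets_dense:
  assumes K: "compact K" "K \<subseteq> {1..d} \<rightarrow>\<^sub>E UNIV" and f: "continuous_on K f" and e: "e > 0"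
  shows "\<exists>L0. \<forall>L\<ge>L0. \<exists>g\<in>nets \<sigma> d L. \<forall>x\<in>K. \<bar>f x - g x\<bar> < e"
proof -
  \<comment> \<open>Products cost a layer, so the ring is formed over all depths together;
    \<open>lift\<close> brings two of its members to a common depth.\<close>
  define R where "R = {f. continuous_on K f \<and> (\<exists>L. f \<in> unif_closure K (nets \<sigma> d L))}"
  have lift: "\<exists>L. f \<in> unif_closure K (nets \<sigma> d L) \<and> g \<in> unif_closure K (nets \<sigma> d L)" if fg: "f \<in> R" "g \<in> R" for f g
  proof -
    obtain L L' where L: "f \<in> unif_closure K (nets \<sigma> d L)" "g \<in> unif_closure K (nets \<sigma> d L')"
      using fg by (auto simp: R_def)
    obtain M M' where "\<forall>x\<in>K. \<bar>f x\<bar> \<le> M" "\<forall>x\<in>K. \<bar>g x\<bar> \<le> M'"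
      using fg compact_bounded_abs[OF K(1), of f] compact_bounded_abs[OF K(1), of g]
      by (auto simp: R_def)
    then show ?thesis
      using unif_closure_nets_mono[OF L(1), of M "max L L'"] unif_closure_nets_mono[OF L(2), of M' "max L L'"] by auto
  qed
  interpret function_ring_on R K
  proof
    show "compact K" by (rule K(1))
    show "continuous_on K f" if "f \<in> R" for f using that by (simp add: R_def)
    show "(\<lambda>x. f x + g x) \<in> R" if fg: "f \<in> R" "g \<in> R" for f g
    proof -
      obtain L where "f \<in> unif_closure K (nets \<sigma> d L)" "g \<in> unif_closure K (nets \<sigma> d L)" using lift[OF fg] by blast
      then have "(\<lambda>x. f x + 1 * g x) \<in> unif_closure K (nets \<sigma> d L)" by (rule unif_closure_nets_lincomb)
      then show ?thesis using fg by (auto simp: R_def intro: continuous_intros)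
    qed
    show "(\<lambda>x. f x * g x) \<in> R" if fg: "f \<in> R" "g \<in> R" for f g
    proof -
      obtain L where L: "f \<in> unif_closure K (nets \<sigma> d L)" "g \<in> unif_closure K (nets \<sigma> d L)" using lift[OF fg] by blast
      have c: "continuous_on K f" "continuous_on K g" using fg by (auto simp: R_def)
      obtain M where M: "\<forall>x\<in>K. \<bar>f x\<bar> \<le> M" using compact_bounded_abs[OF K(1) c(1)] by blast
      obtain M' where M': "\<forall>x\<in>K. \<bar>g x\<bar> \<le> M'" using compact_bounded_abs[OF K(1) c(2)] by blast
      have "(\<lambda>x. f x * g x) \<in> unif_closure K (nets \<sigma> d (Suc L))"
        by (rule unif_closure_nets_mult[OF L(1) M L(2) M'])
      moreover have "continuous_on K (\<lambda>x. f x * g x)" by (intro continuous_on_mult c)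
      ultimately show ?thesis unfolding R_def by blast
    qed
    show "(\<lambda>_. c) \<in> R" for c
      unfolding R_def using subsetD[OF unif_closure_subset const_in_nets[of c \<sigma> d 0], of K]
      by (auto simp del: nets.simps)
    show "\<exists>f\<in>R. f x \<noteq> f y" if "x \<in> K" "y \<in> K" "x \<noteq> y" for x y
    proof -
      \<comment> \<open>Points of \<open>K\<close> agree outside \<open>{1..d}\<close> by
        extensionality, so the coordinates in \<open>{1..d}\<close> separate them.\<close>
      have "\<exists>j\<in>{1..d}. x j \<noteq> y j"
      proof (rule ccontr)
        assume "\<not> (\<exists>j\<in>{1..d}. x j \<noteq> y j)"
        then have "x = y"
          using that(1,2) K(2) by (intro PiE_ext[of x "{1..d}" "\<lambda>_. UNIV" y]) auto
        with that(3) show False by simp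
      qed
      then obtain j where j: "j \<in> {1..d}" "x j \<noteq> y j" by blast
      have "(\<lambda>x. x j) \<in> nets \<sigma> d 0" using j(1) by (auto intro!: aff_span_base)
      then have "(\<lambda>x. x j) \<in> unif_closure K (nets \<sigma> d 0)" using unif_closure_subset by blast
      moreover have "continuous_on K (\<lambda>x. x j)"
        by (rule continuous_on_subset[OF continuous_on_product_coordinates]) simp
      ultimately have "(\<lambda>x. x j) \<in> R" unfolding R_def by blast
      then show ?thesis using j(2) by (intro bexI[of _ "\<lambda>x. x j"])
    qed
  qed
  obtain h where h: "h \<in> R" "\<And>x. x \<in> K \<Longrightarrow> \<bar>f x - h x\<bar> < e/2"
    using Stone_Weierstrass_basic[OF f, of "e/2"] e by auto
  then obtain L0 where L0: "h \<in> unif_closure K (nets \<sigma> d L0)" and hc: "continuous_on K h" by (auto simp: R_def)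
  obtain M where M: "\<forall>x\<in>K. \<bar>h x\<bar> \<le> M" using compact_bounded_abs[OF K(1) hc] by blast
  have "\<exists>g\<in>nets \<sigma> d L. \<forall>x\<in>K. \<bar>f x - g x\<bar> < e" if LL: "L \<ge> L0" for L
  proof -
    obtain g where g: "g \<in> nets \<sigma> d L" "\<And>x. x \<in> K \<Longrightarrow> \<bar>h x - g x\<bar> < e/2"
      using unif_closureD[OF unif_closure_nets_mono[OF L0 M LL], of "e/2"] e by auto
    have "\<bar>f x - g x\<bar> < e" if "x \<in> K" for x
      using h(2)[OF that] g(2)[OF that] by linarith
    with g(1) show ?thesis by blast
  qed
  then show ?thesis by blast
qed

end

section \<open>Scalar networks of equal depth as one layered network\<close>

lemma aff_span_common_basis:
  fixes f :: "nat \<Rightarrow> 'a \<Rightarrow> real" and k :: nat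
  assumes f: "\<forall>i\<in>{1..k}. f i \<in> aff_span B" and B: "B \<noteq> {}"
  shows "\<exists>(e::nat) g W b. 0 < e \<and> (\<forall>j\<in>{1..e}. g j \<in> B) \<and>
    (\<forall>i\<in>{1..k}. f i = (\<lambda>x. (\<Sum>j=1..e. W i j * g j x) + b i))"
proof -
  have "\<forall>i\<in>{1..k}. \<exists>A c b. finite A \<and> A \<subseteq> B \<and> f i = (\<lambda>x. (\<Sum>g\<in>A. c g * g x) + b)"
    by (intro ballI aff_span_finite_basis) (use f in auto)
  from bchoice[OF this] obtain A where
    "\<forall>i\<in>{1..k}. \<exists>c b. finite (A i) \<and> A i \<subseteq> B \<and> f i = (\<lambda>x. (\<Sum>g\<in>A i. c g * g x) + b)" ..
  from bchoice[OF this] obtain c where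
    "\<forall>i\<in>{1..k}. \<exists>b. finite (A i) \<and> A i \<subseteq> B \<and> f i = (\<lambda>x. (\<Sum>g\<in>A i. c i g * g x) + b)" ..
  from bchoice[OF this] obtain b where
    A: "\<forall>i\<in>{1..k}. finite (A i) \<and> A i \<subseteq> B \<and> f i = (\<lambda>x. (\<Sum>g\<in>A i. c i g * g x) + b i)" ..
  then have fi: "f i = (\<lambda>x. (\<Sum>g\<in>A i. c i g * g x) + b i)" if "i \<in> {1..k}" for i
    using that by blast
  obtain g0 where g0: "g0 \<in> B" using B by blast
  \<comment> \<open>The outputs of a layer share one set of hidden units, the union of their bases,
    with weight 0 on foreign units. Inserting \<open>g0\<close> keeps the width positive even if
    every output is constant.\<close>
  define U where "U = insert g0 (\<Union>i\<in>{1..k}. A i)"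
  have U: "finite U" "U \<subseteq> B" "U \<noteq> {}" using A g0 by (auto simp: U_def)
  obtain g where g: "bij_betw g {1..card U} U"
    using ex_bij_betw_nat_finite_1[OF U(1)] by blast
  define W where "W i j = (if g j \<in> A i then c i (g j) else 0)" for i j
  have "f i = (\<lambda>x. (\<Sum>j=1..card U. W i j * g j x) + b i)" if i: "i \<in> {1..k}" for i
  proof
    fix x
    have "(\<Sum>j=1..card U. W i j * g j x) = (\<Sum>h\<in>U. (if h \<in> A i then c i h else 0) * h x)"
      unfolding W_def by (rule sum.reindex_bij_betw[OF g])
    also have "\<dots> = (\<Sum>h\<in>A i. c i h * h x)"
      using U(1) i by (intro sum.mono_neutral_cong_right) (auto simp: U_def)
    finally show "f i x = (\<Sum>j=1..card U. W i j * g j x) + b i" using fi[OF i] by simp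
  qed
  moreover have "\<forall>j\<in>{1..card U}. g j \<in> B" using g U(2) by (auto simp: bij_betw_def)
  moreover have "0 < card U" using U by (simp add: card_gt_0_iff)
  ultimately show ?thesis by blast
qed

lemma nets_0_affine:
  assumes "f \<in> nets \<sigma> d 0"
  shows "\<exists>w b. f = (\<lambda>x. (\<Sum>j=1..d. w j * x j) + b)"
  using assms unfolding nets.simps
proof induction
  case (const c)
  show ?case by (rule exI[of _ "\<lambda>_. 0"]) auto
next
  case (add_scaled f g c)
  then obtain w b i where f: "f = (\<lambda>x. (\<Sum>j=1..d. w j * x j) + b)"
    and g: "i \<in> {1..d}" "g = (\<lambda>x. x i)" by auto
  have "(\<Sum>j=1..d. (w(i := w i + c)) j * x j) = (\<Sum>j=1..d. w j * x j) + c * x i" for x :: "nat \<Rightarrow> real"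
  proof -
    have "(\<Sum>j=1..d. (w(i := w i + c)) j * x j) = (\<Sum>j=1..d. w j * x j + (if j = i then c * x i else 0))"
      by (intro sum.cong) (auto simp: algebra_simps)
    then show ?thesis using g(1) by (simp add: sum.distrib)
  qed
  then have "(\<lambda>x. f x + c * g x) = (\<lambda>x. (\<Sum>j=1..d. (w(i := w i + c)) j * x j) + b)"
    by (simp add: f g(2) fun_eq_iff)
  then show ?case by blast
qed

text \<open>The hidden units of all outputs are pooled, and the induction hypothesis supplies one
  network computing all their inputs; hence \<open>k\<close> and \<open>f\<close> vary in the
  induction. Depth \<open>Suc L\<close> reflects that \<open>fcnn\<close> has at least one hidden
  layer.\<close>

lemma fcnn_of_nets:
  assumes "\<forall>i\<in>{1..k}. f i \<in> nets \<sigma> d (Suc L)"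
  shows "\<exists>T. fcnn \<sigma> d k T \<and> (\<forall>x. \<forall>i\<in>{1..k}. T x i = f i x)"
  using assms
proof (induction L arbitrary: k f)
  case 0
  have ne: "(\<lambda>f x. \<sigma> (f x)) ` nets \<sigma> d 0 \<noteq> {}" using const_in_nets[of 0 \<sigma> d 0] by blast
  have "\<forall>i\<in>{1..k}. f i \<in> aff_span ((\<lambda>f x. \<sigma> (f x)) ` nets \<sigma> d 0)"
    using 0 by simp
  from aff_span_common_basis[OF this ne]
  obtain e :: nat and g W b where e: "0 < e" and g: "\<forall>j\<in>{1..e}. g j \<in> (\<lambda>f x. \<sigma> (f x)) ` nets \<sigma> d 0"
    and f: "\<forall>i\<in>{1..k}. f i = (\<lambda>x. (\<Sum>j=1..e. W i j * g j x) + b i)"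
    by (elim exE conjE) (rule that; assumption)
  have "\<forall>j. \<exists>w c. j \<in> {1..e} \<longrightarrow> g j = (\<lambda>x. \<sigma> ((\<Sum>l=1..d. w l * x l) + c))"
    using g nets_0_affine by fast
  then obtain w c where gj: "\<And>j. j \<in> {1..e} \<Longrightarrow> g j = (\<lambda>x. \<sigma> ((\<Sum>l=1..d. w j l * x l) + c j))"
    by metis
  define A where "A = (\<lambda>x. \<lambda>j\<in>{1..e}. (\<Sum>l=1..d. w j l * x l) + c j)"
  define A' where "A' = (\<lambda>x. \<lambda>i\<in>{1..k}. (\<Sum>j=1..e. W i j * x j) + b i)"
  have "fcnn \<sigma> d k (A' \<circ> activate \<sigma> e \<circ> A)"
    using e by (intro fcnn.shallow) (auto simp: affine_layer_def A_def A'_def)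
  moreover have "(A' \<circ> activate \<sigma> e \<circ> A) x i = f i x" if "i \<in> {1..k}" for x i
    using that f gj by (simp add: A_def A'_def activate_def)
  ultimately show ?case by blast
next
  case (Suc L)
  have ne: "(\<lambda>f x. \<sigma> (f x)) ` nets \<sigma> d (Suc L) \<noteq> {}" using const_in_nets[of 0 \<sigma> d "Suc L"] by blast
  have "\<forall>i\<in>{1..k}. f i \<in> aff_span ((\<lambda>f x. \<sigma> (f x)) ` nets \<sigma> d (Suc L))"
    using Suc.prems by simp
  from aff_span_common_basis[OF this ne]
  obtain e :: nat and g W b where e: "0 < e" and g: "\<forall>j\<in>{1..e}. g j \<in> (\<lambda>f x. \<sigma> (f x)) ` nets \<sigma> d (Suc L)"
    and f: "\<forall>i\<in>{1..k}. f i = (\<lambda>x. (\<Sum>j=1..e. W i j * g j x) + b i)"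
    by (elim exE conjE) (rule that; assumption)
  have "\<forall>j. \<exists>h. j \<in> {1..e} \<longrightarrow> h \<in> nets \<sigma> d (Suc L) \<and> g j = (\<lambda>x. \<sigma> (h x))"
    using g by fast
  then obtain h where h: "\<And>j. j \<in> {1..e} \<Longrightarrow> h j \<in> nets \<sigma> d (Suc L)"
    and gj: "\<And>j. j \<in> {1..e} \<Longrightarrow> g j = (\<lambda>x. \<sigma> (h j x))"
    by metis
  obtain T where T: "fcnn \<sigma> d e T" "\<And>x j. j \<in> {1..e} \<Longrightarrow> T x j = h j x"
    using Suc.IH[of e h] h by blast
  define A' where "A' = (\<lambda>x. \<lambda>i\<in>{1..k}. (\<Sum>j=1..e. W i j * x j) + b i)"
  have "fcnn \<sigma> d k (A' \<circ> activate \<sigma> e \<circ> T)"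
    using e T(1) by (intro fcnn.deeper) (auto simp: affine_layer_def A'_def)
  moreover have "(A' \<circ> activate \<sigma> e \<circ> T) x i = f i x" if "i \<in> {1..k}" for x i
    using that f gj T(2) by (simp add: A'_def activate_def)
  ultimately show ?case by blast
qed

context nonaffine_activation
begin

theorem fcnn_universal_approximation:
  assumes K: "compact K" "K \<subseteq> {1..d} \<rightarrow>\<^sub>E UNIV" and f: "\<And>i. i \<in> {1..k} \<Longrightarrow> continuous_on K (f i)"
    and e: "e > 0"
  shows "\<exists>T. fcnn \<sigma> d k T \<and>
    (\<forall>i\<in>{1..k}. continuous_on UNIV (\<lambda>x. T x i) \<and> (\<forall>x\<in>K. \<bar>f i x - T x i\<bar> < e))"
proof -
  have "\<forall>i. \<exists>L0. i \<in> {1..k} \<longrightarrow> (\<forall>L\<ge>L0. \<exists>g\<in>nets \<sigma> d L. \<forall>x\<in>K. \<bar>f i x - g x\<bar> < e)"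
    using nets_dense[OF K f e] by blast
  then obtain L0 where L0: "\<And>i L. i \<in> {1..k} \<Longrightarrow> L \<ge> L0 i \<Longrightarrow>
      \<exists>g\<in>nets \<sigma> d L. \<forall>x\<in>K. \<bar>f i x - g x\<bar> < e" by metis
  \<comment> \<open>A sum of naturals dominates each threshold, also when \<open>k = 0\<close>; the
    successor then guarantees a hidden layer.\<close>
  define L where "L = (\<Sum>i=1..k. L0 i)"
  have "L0 i \<le> Suc L" if "i \<in> {1..k}" for i
    using member_le_sum[of i "{1..k}" L0] that by (simp add: L_def)
  then have "\<forall>i. \<exists>g. i \<in> {1..k} \<longrightarrow> g \<in> nets \<sigma> d (Suc L) \<and> (\<forall>x\<in>K. \<bar>f i x - g x\<bar> < e)"
    using L0 by blast
  then obtain g where g: "\<And>i. i \<in> {1..k} \<Longrightarrow> g i \<in> nets \<sigma> d (Suc L)"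
    "\<And>i. i \<in> {1..k} \<Longrightarrow> \<forall>x\<in>K. \<bar>f i x - g i x\<bar> < e" by metis
  obtain T where T: "fcnn \<sigma> d k T" "\<And>x i. i \<in> {1..k} \<Longrightarrow> T x i = g i x"
    using fcnn_of_nets[of k g] g(1) by blast
  have "continuous_on UNIV (\<lambda>x. T x i) \<and> (\<forall>x\<in>K. \<bar>f i x - T x i\<bar> < e)" if "i \<in> {1..k}" for i
    using nets_continuous[OF cont g(1)[OF that]] g(2)[OF that] T(2)[OF that] by simp
  with T(1) show ?thesis by blast
qed

end

subsection \<open>DeepONets that are nearly the identity\<close>

lemma compact_PiE_interval:
  fixes a b :: real
  shows "compact ({1..m::nat} \<rightarrow>\<^sub>E {a..b})"
proof -
  \<comment> \<open>Extensional functions take the value \<open>undefined\<close> off the index set,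
    so the box is a full product with singleton factors there and Tychonoff applies.\<close>
  have eq: "({1..m} \<rightarrow>\<^sub>E {a..b}) = (\<Pi>\<^sub>E i\<in>UNIV. if i \<in> {1..m} then {a..b} else {undefined})"
    by (auto simp: PiE_iff extensional_def split: if_splits)
  have "compactin (product_topology (\<lambda>i::nat. euclidean) UNIV)
      (\<Pi>\<^sub>E i\<in>UNIV. if i \<in> {1..m} then {a..b} else {undefined :: real})"
    unfolding compactin_PiE by (auto simp: compactin_euclidean_iff)
  then show ?thesis
    unfolding eq by (simp add: euclidean_product_topology compactin_euclidean_iff)
qed

text \<open>Hat functions of radius \<open>d\<close> at equispaced nodes are divided by their sum,
  which is positive because the mesh is below \<open>d\<close>.\<close>

lemma interval_partition_of_unity:
  fixes d :: real
  assumes d: "d > 0"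
  shows "\<exists>(m::nat) z (\<beta> :: nat \<Rightarrow> real \<Rightarrow> real). 0 < m \<and> (\<forall>p\<in>{1..m}. z p \<in> {0..1} \<and> continuous_on {0..1} (\<beta> p)) \<and>
    (\<forall>y\<in>{0..1}. (\<Sum>p=1..m. \<beta> p y) = 1 \<and>
      (\<forall>p\<in>{1..m}. 0 \<le> \<beta> p y \<and> (\<beta> p y \<noteq> 0 \<longrightarrow> \<bar>z p - y\<bar> < d)))"
proof -
  obtain n where n: "1 / d < real n" using reals_Archimedean2 by blast
  have "real n > 0" using n d by (meson divide_pos_pos order_less_trans zero_less_one)
  then have n0: "n > 0" "1 / n < d" using n d by (auto simp: field_simps)
  \<comment> \<open>Indices start at 1, so the nodes are 0, 1/n, ..., 1.\<close>
  define z where "z p = real (p - 1) / n" for p :: nat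
  define u where "u p y = max 0 (d - \<bar>z p - y\<bar>)" for p y
  define S where "S y = (\<Sum>p=1..Suc n. u p y)" for y
  have S: "S y > 0" if y: "y \<in> {0..1}" for y
  proof -
    \<comment> \<open>The nearest node at or below \<open>y\<close> is \<open>z (Suc k)\<close>, at
      distance less than \<open>1 / n\<close>.\<close>
    define k where "k = nat \<lfloor>y * n\<rfloor>"
    have "y * n \<le> n" using y by (simp add: mult_left_le_one_le)
    have k: "real k \<le> y * n" "y * n < real k + 1"
      using y by (auto simp: k_def)
    then have "k \<le> n" using \<open>y * n \<le> n\<close> by linarith
    have "real k / n \<le> y" "y < real k / n + 1 / n"
      using k n0(1) by (auto simp: field_simps)
    then have "u (Suc k) y > 0" using n0(2) by (auto simp: u_def z_def)
    moreover have "u (Suc k) y \<le> S y"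
      unfolding S_def by (rule member_le_sum) (use \<open>k \<le> n\<close> in \<open>auto simp: u_def\<close>)
    ultimately show ?thesis by linarith
  qed
  define \<beta> where "\<beta> p y = u p y / S y" for p y
  have u: "continuous_on {0..1} (u p)" for p unfolding u_def by (intro continuous_intros)
  have "continuous_on {0..1} S" unfolding S_def by (intro continuous_on_sum u)
  then have "continuous_on {0..1} (\<beta> p)" for p
    unfolding \<beta>_def using S by (intro continuous_on_divide u) force+
  moreover have "z p \<in> {0..1}" if "p \<in> {1..Suc n}" for p
    using that n0(1) by (auto simp: z_def divide_le_eq_1)
  moreover have "(\<Sum>p=1..Suc n. \<beta> p y) = 1" if "y \<in> {0..1}" for y
    using S[OF that] unfolding \<beta>_def by (simp only: sum_divide_distrib[symmetric] S_def[symmetric])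
      simp
  moreover have "0 \<le> \<beta> p y" if "y \<in> {0..1}" for p y
    using S[OF that] by (simp add: \<beta>_def u_def)
  moreover have "\<bar>z p - y\<bar> < d" if "\<beta> p y \<noteq> 0" for p y
    using that by (auto simp: \<beta>_def u_def max_def split: if_splits)
  ultimately show ?thesis
    by (rule_tac x = "Suc n" in exI, rule_tac x = z in exI, rule_tac x = \<beta> in exI) auto
qed

lemma continuous_on_fun_upd:
  "continuous_on S f \<Longrightarrow> continuous_on S g \<Longrightarrow> continuous_on S (\<lambda>x. (f x)(n := g x))"
  for f :: "'a::topological_space \<Rightarrow> nat \<Rightarrow> real"
  by (rule continuous_on_coordinatewise_then_product, rename_tac i, case_tac "i = n")
    (auto intro: continuous_on_product_then_coordinatewise)

lemma compact_cube: "compact (cube N)"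
  unfolding cube_def by (rule compact_PiE_interval)

text \<open>Equicontinuity of the slices comes from uniform continuity, on a compact product, of the
  joint map in base point and replaced coordinate.\<close>

lemma uniformly_continuous_slices:
  assumes X: "X \<in> cfun (cube N)" and n: "n \<in> {1..N}" and e: "e > 0"
  shows "\<exists>d>0. \<forall>y\<in>cube N. \<forall>s\<in>{0..1}. \<forall>s'\<in>{0..1}. \<bar>s' - s\<bar> < d \<longrightarrow>
    \<bar>X (y(n := s')) - X (y(n := s))\<bar> < e"
proof -
  define h where "h = (\<lambda>q :: (nat \<Rightarrow> real) \<times> real. X ((fst q)(n := snd q)))"
  have "continuous_on (cube N \<times> {0..1}) h"
    unfolding h_def
  proof (rule continuous_on_compose2[of "cube N" X])
    show "continuous_on (cube N) X" using X by (simp add: cfun_def)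
    show "continuous_on (cube N \<times> {0..1}) (\<lambda>q. (fst q)(n := snd q))"
      by (intro continuous_on_fun_upd continuous_intros)
    show "(\<lambda>q. (fst q)(n := snd q)) ` (cube N \<times> {0..1}) \<subseteq> cube N"
      using fun_upd_cube[OF _ n] by auto
  qed
  then have "uniformly_continuous_on (cube N \<times> {0..1}) h"
    by (intro compact_uniformly_continuous compact_Times compact_cube) auto
  then obtain d where d: "d > 0" "\<forall>x\<in>cube N \<times> {0..1}. \<forall>x'\<in>cube N \<times> {0..1}.
      dist x' x < d \<longrightarrow> dist (h x') (h x) < e"
    unfolding uniformly_continuous_on_def using e by meson
  have "\<bar>X (y(n := s')) - X (y(n := s))\<bar> < e"
    if "y \<in> cube N" "s \<in> {0..1}" "s' \<in> {0..1}" "\<bar>s' - s\<bar> < d" for y s s'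
    using d(2)[rule_format, of "(y, s)" "(y, s')"] that
    by (simp add: h_def dist_Pair_Pair dist_real_def)
  with d(1) show ?thesis by blast
qed

section \<open>Branch networks, trunk networks and their composition\<close>

context nonaffine_activation
begin

text \<open>Branch \<open>p\<close> is to return the \<open>p\<close>-th sensor value, so a
  coordinate projection is approximated on the box of possible values.\<close>

lemma branch_networks:
  assumes e: "e > 0"
  shows "\<exists>b. \<forall>p\<in>{1..m}. scalar_fcnn \<sigma> m ({1..m} \<rightarrow>\<^sub>E UNIV) (b p) \<and> b p \<in> cfun ({1..m} \<rightarrow>\<^sub>E UNIV) \<and>
    (\<forall>x\<in>{1..m} \<rightarrow>\<^sub>E {-M..M}. \<bar>x p - b p x\<bar> < e)"
proof (intro bchoice ballI)
  fix p
  let ?K = "{1..m} \<rightarrow>\<^sub>E {-M..M}" and ?U = "{1..m} \<rightarrow>\<^sub>E (UNIV :: real set)"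
  have sub: "?K \<subseteq> ?U" by auto
  have "continuous_on ?K (\<lambda>x. x p)"
    by (rule continuous_on_subset[OF continuous_on_product_coordinates]) simp
  from fcnn_universal_approximation[OF compact_PiE_interval sub this e, of 1]
  obtain T where T: "fcnn \<sigma> m 1 T" "continuous_on UNIV (\<lambda>x. T x 1)" "\<forall>x\<in>?K. \<bar>x p - T x 1\<bar> < e"
    by auto
  define b where "b = (\<lambda>x\<in>?U. T x 1)"
  have "scalar_fcnn \<sigma> m ?U b" unfolding scalar_fcnn_def b_def using T(1) by blast
  moreover have "b \<in> cfun ?U"
    unfolding b_def by (intro restrict_cfun continuous_on_subset[OF T(2)]) simp
  moreover have "\<forall>x\<in>?K. \<bar>x p - b x\<bar> < e"
    using T(3) sub by (auto simp: b_def)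
  ultimately show "\<exists>b. scalar_fcnn \<sigma> m ?U b \<and> b \<in> cfun ?U \<and> (\<forall>x\<in>?K. \<bar>x p - b x\<bar> < e)"
    by blast
qed

text \<open>One vector-valued network serves all partition functions; a real \<open>y\<close> enters
  it as a point of the one-dimensional extensional space.\<close>

lemma trunk_network:
  assumes \<beta>: "\<forall>p\<in>{1..P}. continuous_on {0..1} (\<beta> p)" and e: "e > 0"
  shows "\<exists>T. fcnn \<sigma> 1 P T \<and> (\<forall>p\<in>{1..P}. (\<lambda>y\<in>{0..1}. T (\<lambda>i\<in>{1..1}. y) p) \<in> cfun {0..1} \<and>
    (\<forall>y\<in>{0..1}. \<bar>\<beta> p y - T (\<lambda>i\<in>{1..1}. y) p\<bar> < e))"
proof -
  let ?K = "{1..1::nat} \<rightarrow>\<^sub>E {0..1::real}"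
  have sub: "?K \<subseteq> {1..1} \<rightarrow>\<^sub>E UNIV" by auto
  have c: "continuous_on ?K (\<lambda>x. \<beta> p (x 1))" if "p \<in> {1..P}" for p
  proof (rule continuous_on_compose2[of "{0..1}" "\<beta> p"])
    show "continuous_on {0..1} (\<beta> p)" using \<beta> that by blast
    show "continuous_on ?K (\<lambda>x. x 1)"
      by (rule continuous_on_subset[OF continuous_on_product_coordinates]) simp
  qed auto
  obtain T where T: "fcnn \<sigma> 1 P T"
    "\<forall>p\<in>{1..P}. continuous_on UNIV (\<lambda>x. T x p) \<and> (\<forall>x\<in>?K. \<bar>\<beta> p (x 1) - T x p\<bar> < e)"
    using fcnn_universal_approximation[OF compact_PiE_interval sub _ e, of P "\<lambda>p x. \<beta> p (x 1)"] c
    by auto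
  have emb: "continuous_on {0..1} (\<lambda>y::real. \<lambda>i\<in>{1..1::nat}. y)"
    by (rule continuous_on_coordinatewise_then_product, rename_tac i, case_tac "i = 1")
      (auto intro: continuous_intros)
  have "(\<lambda>y\<in>{0..1}. T (\<lambda>i\<in>{1..1}. y) p) \<in> cfun {0..1} \<and>
    (\<forall>y\<in>{0..1}. \<bar>\<beta> p y - T (\<lambda>i\<in>{1..1}. y) p\<bar> < e)" if p: "p \<in> {1..P}" for p
  proof
    have "continuous_on UNIV (\<lambda>x. T x p)" using T(2) p by blast
    then show "(\<lambda>y\<in>{0..1}. T (\<lambda>i\<in>{1..1}. y) p) \<in> cfun {0..1}"
      by (intro restrict_cfun continuous_on_compose2[OF _ emb]) auto
    show "\<forall>y\<in>{0..1}. \<bar>\<beta> p y - T (\<lambda>i\<in>{1..1}. y) p\<bar> < e"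
    proof
      fix y :: real assume "y \<in> {0..1}"
      then have y: "(\<lambda>i\<in>{1..1}. y) \<in> ?K" by auto
      have "\<forall>x\<in>?K. \<bar>\<beta> p (x 1) - T x p\<bar> < e" using T(2) p by blast
      from bspec[OF this y] show "\<bar>\<beta> p y - T (\<lambda>i\<in>{1..1}. y) p\<bar> < e" by simp
    qed
  qed
  with T(1) show ?thesis by blast
qed

text \<open>The operator mimics interpolation of \<open>v (z p)\<close> by the partition functions.
  Only sensor values of \<open>G\<close> enter, so closeness to \<open>X\<close> is enough and the
  oscillation is controlled by the slices of \<open>X\<close>.\<close>

lemma deeponet_near_identity:
  assumes X: "X \<in> cfun (cube N)" and n: "n \<in> {1..N}" and e: "\<epsilon> > 0"
  shows "\<exists>\<delta>>0. \<exists>F. deeponet \<sigma> F \<and> (\<forall>G\<in>cfun (cube N). (\<forall>y\<in>cube N. \<bar>X y - G y\<bar> < \<delta>) \<longrightarrow>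
    (\<forall>y\<in>cube N. \<bar>X y - mode_op N n F G y\<bar> < \<epsilon>))"
proof -
  obtain M0 where M0: "\<forall>y\<in>cube N. \<bar>X y\<bar> \<le> M0"
    using compact_bounded_abs[OF compact_cube, of N X] X by (auto simp: cfun_def)
  define M where "M = \<bar>M0\<bar>"
  have M: "\<bar>X y\<bar> \<le> M" if "y \<in> cube N" for y
    using bspec[OF M0 that] by (auto simp: M_def)
  have M_nonneg: "M \<ge> 0" by (simp add: M_def)
  obtain d where d: "d > 0" "\<forall>y\<in>cube N. \<forall>s\<in>{0..1}. \<forall>s'\<in>{0..1}. \<bar>s' - s\<bar> < d \<longrightarrow>
    \<bar>X (y(n := s')) - X (y(n := s))\<bar> < \<epsilon>/4"
    using uniformly_continuous_slices[OF X n, of "\<epsilon>/4"] e by auto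
  obtain m :: nat and z and \<beta> :: "nat \<Rightarrow> real \<Rightarrow> real" where m: "0 < m"
    and z: "\<forall>p\<in>{1..m}. z p \<in> {0..1} \<and> continuous_on {0..1} (\<beta> p)"
    and part: "\<forall>y\<in>{0..1}. (\<Sum>p=1..m. \<beta> p y) = 1 \<and>
      (\<forall>p\<in>{1..m}. 0 \<le> \<beta> p y \<and> (\<beta> p y \<noteq> 0 \<longrightarrow> \<bar>z p - y\<bar> < d))"
    using interval_partition_of_unity[OF d(1)] by (elim exE conjE) (rule that; assumption)
  \<comment> \<open>The bound 1 keeps sensor values of \<open>G\<close> in the box of radius
    \<open>M + 1\<close> and trunk values below 2; the other bound keeps \<open>m\<close> network
    errors of size \<open>\<eta> * (M + 4)\<close> within \<open>\<epsilon>/4\<close>. The same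
    \<open>\<eta>\<close> is the required \<open>\<delta>\<close>.\<close>
  define \<eta> where "\<eta> = min 1 (\<epsilon> / (4 * real m * (M + 4)))"
  have \<eta>: "\<eta> > 0" "\<eta> \<le> 1" using e m M_nonneg by (auto simp: \<eta>_def)
  have "\<eta> \<le> \<epsilon> / (4 * real m * (M + 4))" by (simp add: \<eta>_def)
  moreover have "4 * real m * (M + 4) > 0" using m M_nonneg by simp
  ultimately have "\<eta> * (4 * real m * (M + 4)) \<le> \<epsilon>" by (simp only: pos_le_divide_eq)
  then have \<eta>m: "real m * (\<eta> * (M + 4)) \<le> \<epsilon>/4" by (simp add: mult_ac)
  obtain b where b: "\<forall>p\<in>{1..m}. scalar_fcnn \<sigma> m ({1..m} \<rightarrow>\<^sub>E UNIV) (b p) \<and>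
      b p \<in> cfun ({1..m} \<rightarrow>\<^sub>E UNIV) \<and> (\<forall>x\<in>{1..m} \<rightarrow>\<^sub>E {-(M+1)..M+1}. \<bar>x p - b p x\<bar> < \<eta>)"
    using branch_networks[OF \<eta>(1)] ..
  obtain T where T: "fcnn \<sigma> 1 m T"
    "\<forall>p\<in>{1..m}. (\<lambda>y\<in>{0..1}. T (\<lambda>i\<in>{1..1}. y) p) \<in> cfun {0..1} \<and>
      (\<forall>y\<in>{0..1}. \<bar>\<beta> p y - T (\<lambda>i\<in>{1..1}. y) p\<bar> < \<eta>)"
    using trunk_network[of m \<beta>, OF _ \<eta>(1)] z by auto
  define t where "t p = (\<lambda>y\<in>{0..1}. T (\<lambda>i\<in>{1..1}. y) p)" for p
  define F where "F v = (\<lambda>y\<in>{0..1}. \<Sum>p=1..m. b p (\<lambda>i\<in>{1..m}. v (z i)) * t p y)" for v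
  have "deeponet \<sigma> F"
    unfolding deeponet_def
    by (rule exI[of _ m], rule exI[of _ m], rule exI[of _ z], rule exI[of _ b], rule exI[of _ T],
        rule exI[of _ t]) (use m z b T in \<open>auto simp: t_def F_def\<close>)
  moreover have "\<bar>X y - mode_op N n F G y\<bar> < \<epsilon>"
    if G: "G \<in> cfun (cube N)" "\<forall>y\<in>cube N. \<bar>X y - G y\<bar> < \<eta>" and y: "y \<in> cube N" for G y
  proof -
    define r where "r = y n"
    have r: "r \<in> {0..1}" using y n by (auto simp: cube_def r_def)
    define a where "a p = X (y(n := z p))" for p
    define x where "x = (\<lambda>i\<in>{1..m}. G (y(n := z i)))"
    have cube: "y(n := z p) \<in> cube N" if "p \<in> {1..m}" for p
      using fun_upd_cube[OF y n] z that by blast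
    have xa: "\<bar>x p - a p\<bar> < \<eta>" if "p \<in> {1..m}" for p
      using bspec[OF G(2) cube[OF that]] that by (simp add: x_def a_def abs_minus_commute)
    have xbox: "x \<in> {1..m} \<rightarrow>\<^sub>E {-(M+1)..M+1}"
    proof (rule PiE_I)
      fix i assume i: "i \<in> {1..m}"
      show "x i \<in> {-(M+1)..M+1}"
        using xa[OF i] M[OF cube[OF i]] \<eta>(2) by (auto simp: a_def)
    qed (auto simp: x_def)
    have "(\<lambda>i\<in>{1..m}. (\<lambda>s\<in>{0..1}. G (y(n := s))) (z i)) = x"
      unfolding x_def using z by (intro restrict_ext) simp
    then have op: "mode_op N n F G y = (\<Sum>p=1..m. b p x * t p r)"
      using y r by (simp add: mode_op_def F_def r_def)
    \<comment> \<open>The partition of unity spreads \<open>X y\<close> over the nodes, allowing a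
      comparison term by term.\<close>
    have Xy: "X y = (\<Sum>p=1..m. X y * \<beta> p r)"
      using part r by (simp add: sum_distrib_left[symmetric])
    \<comment> \<open>The first part is the oscillation of the slice, weighted so that it sums to
      \<open>\<epsilon>/4\<close>; the second is the error from sensors, branch and trunk.\<close>
    have "\<bar>X y * \<beta> p r - b p x * t p r\<bar> \<le> \<epsilon>/4 * \<beta> p r + \<eta> * (M + 4)" if p: "p \<in> {1..m}" for p
    proof -
      have \<beta>: "0 \<le> \<beta> p r" "\<beta> p r \<le> 1"
      proof -
        show "0 \<le> \<beta> p r" using part r p by blast
        have "\<beta> p r \<le> (\<Sum>p=1..m. \<beta> p r)"
          by (rule member_le_sum) (use part r p in auto)
        then show "\<beta> p r \<le> 1" using part r by simp
      qed
      have 1: "\<bar>X y * \<beta> p r - a p * \<beta> p r\<bar> \<le> \<epsilon>/4 * \<beta> p r"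
      proof (cases "\<beta> p r = 0")
        case False
        then have "\<bar>z p - r\<bar> < d" using part r p by blast
        then have "\<bar>X (y(n := z p)) - X (y(n := r))\<bar> < \<epsilon>/4" using d(2) y r z p by blast
        then have "\<bar>X y - a p\<bar> \<le> \<epsilon>/4" by (simp add: a_def r_def abs_minus_commute)
        then have "\<bar>X y - a p\<bar> * \<beta> p r \<le> \<epsilon>/4 * \<beta> p r" using \<beta>(1) by (rule mult_right_mono)
        then show ?thesis using \<beta>(1) by (simp add: left_diff_distrib[symmetric] abs_mult)
      qed simp
      have t: "\<bar>\<beta> p r - t p r\<bar> < \<eta>" using T(2) p r by (simp add: t_def)
      have "\<bar>x p - b p x\<bar> < \<eta>" using b p xbox by blast
      \<comment> \<open>One \<open>\<eta>\<close> from replacing \<open>X\<close> by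
        \<open>G\<close> at the sensor, one from the branch network.\<close>
      then have ba: "\<bar>a p - b p x\<bar> \<le> 2 * \<eta>" using xa[OF p] by linarith
      have "\<bar>a p - b p x\<bar> * \<bar>t p r\<bar> \<le> (2 * \<eta>) * 2"
        using ba t \<beta> \<eta> by (intro mult_mono) auto
      moreover have "\<bar>a p\<bar> * \<bar>\<beta> p r - t p r\<bar> \<le> M * \<eta>"
        using M[OF cube[OF p]] t M_nonneg by (intro mult_mono) (auto simp: a_def)
      moreover have "a p * \<beta> p r - b p x * t p r = (a p - b p x) * t p r + a p * (\<beta> p r - t p r)"
        by (simp add: algebra_simps)
      ultimately have "\<bar>a p * \<beta> p r - b p x * t p r\<bar> \<le> (2 * \<eta>) * 2 + M * \<eta>"
        using abs_triangle_ineq[of "(a p - b p x) * t p r" "a p * (\<beta> p r - t p r)"]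
        unfolding abs_mult by linarith
      moreover have "(2 * \<eta>) * 2 + M * \<eta> = \<eta> * (M + 4)" by (simp add: algebra_simps)
      ultimately show ?thesis using 1 by linarith
    qed
    then have "(\<Sum>p=1..m. \<bar>X y * \<beta> p r - b p x * t p r\<bar>) \<le> (\<Sum>p=1..m. \<epsilon>/4 * \<beta> p r + \<eta> * (M + 4))"
      by (rule sum_mono)
    also have "(\<Sum>p=1..m. \<epsilon>/4 * \<beta> p r + \<eta> * (M + 4)) = \<epsilon>/4 + real m * (\<eta> * (M + 4))"
      using part r by (simp add: sum.distrib sum_distrib_left[symmetric] sum_divide_distrib[symmetric])
    finally have "(\<Sum>p=1..m. \<bar>X y * \<beta> p r - b p x * t p r\<bar>) < \<epsilon>" using \<eta>m e by linarith
    moreover have "X y - mode_op N n F G y = (\<Sum>p=1..m. X y * \<beta> p r - b p x * t p r)"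
      unfolding op sum_subtractf using Xy by simp
    ultimately show ?thesis
      using sum_abs[of "\<lambda>p. X y * \<beta> p r - b p x * t p r" "{1..m}"] by linarith
  qed
  ultimately show ?thesis using \<eta>(1) by blast
qed

text \<open>\<open>fold\<close> applies the head first, so the tolerance that the tail demands
  becomes the accuracy asked of the head operator.\<close>

lemma deeponets_near_identity:
  assumes X: "X \<in> cfun (cube N)"
  shows "\<lbrakk>distinct ns; set ns \<subseteq> {1..N}; \<epsilon> > 0\<rbrakk> \<Longrightarrow>
    \<exists>\<delta>>0. \<exists>F. (\<forall>n\<in>set ns. deeponet \<sigma> (F n)) \<and>
      (\<forall>G\<in>cfun (cube N). (\<forall>y\<in>cube N. \<bar>X y - G y\<bar> < \<delta>) \<longrightarrow>
        (\<forall>y\<in>cube N. \<bar>X y - fold (\<lambda>n. mode_op N n (F n)) ns G y\<bar> < \<epsilon>))"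
proof (induction ns)
  case Nil
  then show ?case by auto
next
  case (Cons n ns)
  then obtain \<delta> F where \<delta>: "\<delta> > 0" and F: "\<forall>n\<in>set ns. deeponet \<sigma> (F n)"
    and fold: "\<forall>G\<in>cfun (cube N). (\<forall>y\<in>cube N. \<bar>X y - G y\<bar> < \<delta>) \<longrightarrow>
        (\<forall>y\<in>cube N. \<bar>X y - fold (\<lambda>n. mode_op N n (F n)) ns G y\<bar> < \<epsilon>)"
    by auto
  have n: "n \<in> {1..N}" "n \<notin> set ns" using Cons.prems by auto
  obtain \<delta>' F' where \<delta>': "\<delta>' > 0" and F': "deeponet \<sigma> F'"
    and step: "\<forall>G\<in>cfun (cube N). (\<forall>y\<in>cube N. \<bar>X y - G y\<bar> < \<delta>') \<longrightarrow>
      (\<forall>y\<in>cube N. \<bar>X y - mode_op N n F' G y\<bar> < \<delta>)"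
    using deeponet_near_identity[OF X n(1) \<delta>] by blast
  \<comment> \<open>As the modes are distinct, the update leaves the operators of the tail
    unchanged.\<close>
  let ?F = "F(n := F')"
  have eq: "fold (\<lambda>n. mode_op N n (?F n)) (n # ns) G = fold (\<lambda>n. mode_op N n (F n)) ns (mode_op N n F' G)" for G
    using n(2) by (auto intro!: fold_cong[THEN fun_cong])
  have "\<forall>k\<in>set (n # ns). deeponet \<sigma> (?F k)" using F F' by simp
  moreover have "\<forall>G\<in>cfun (cube N). (\<forall>y\<in>cube N. \<bar>X y - G y\<bar> < \<delta>') \<longrightarrow>
      (\<forall>y\<in>cube N. \<bar>X y - fold (\<lambda>n. mode_op N n (?F n)) (n # ns) G y\<bar> < \<epsilon>)"
    unfolding eq using step fold mode_op_cfun[OF F' _ n(1)] by blast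
  ultimately show ?case using \<delta>' by blast
qed

end

text \<open>The activation is given in advance. Folding over \<open>[1..<Suc N]\<close> applies mode
  1 first and mode \<open>N\<close> last.\<close>

theorem theorem1:
  fixes N :: nat and \<sigma> :: "real \<Rightarrow> real" and X :: "(nat \<Rightarrow> real) \<Rightarrow> real" and \<epsilon> :: real
  assumes "N \<ge> 1"
    and "continuous_on UNIV \<sigma>"
    and "\<nexists>a c. \<forall>x. \<sigma> x = a * x + c"
    and "X \<in> cfun (cube N)"
    and "\<epsilon> > 0"
  shows "\<exists>G F. scalar_fcnn \<sigma> N (cube N) G \<and> G \<in> cfun (cube N) \<and>
    (\<forall>n\<in>{1..N}. deeponet \<sigma> (F n)) \<and>
    sup_norm (cube N) (\<lambda>y. X y - fold (\<lambda>n. mode_op N n (F n)) [1..<Suc N] G y) < \<epsilon>"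
proof -
  interpret nonaffine_activation \<sigma> using assms(2,3) by unfold_locales
  have modes: "set [1..<Suc N] \<subseteq> {1..N}" by auto
  \<comment> \<open>A strict pointwise bound yields only a weak one for the supremum, hence
    \<open>\<epsilon>/2\<close>.\<close>
  obtain \<delta> F where \<delta>: "\<delta> > 0" and F: "\<forall>n\<in>set [1..<Suc N]. deeponet \<sigma> (F n)"
    and fold: "\<forall>G\<in>cfun (cube N). (\<forall>y\<in>cube N. \<bar>X y - G y\<bar> < \<delta>) \<longrightarrow>
        (\<forall>y\<in>cube N. \<bar>X y - fold (\<lambda>n. mode_op N n (F n)) [1..<Suc N] G y\<bar> < \<epsilon>/2)"
    using deeponets_near_identity[OF assms(4) distinct_upt modes, of "\<epsilon>/2"] \<open>\<epsilon> > 0\<close>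
    by auto
  have sub: "cube N \<subseteq> {1..N} \<rightarrow>\<^sub>E UNIV" by (auto simp: cube_def)
  have "continuous_on (cube N) X" using assms(4) by (simp add: cfun_def)
  from fcnn_universal_approximation[OF compact_cube sub this \<delta>, of 1]
  obtain T where T: "fcnn \<sigma> N 1 T" "continuous_on UNIV (\<lambda>x. T x 1)" "\<forall>y\<in>cube N. \<bar>X y - T y 1\<bar> < \<delta>"
    by auto
  define G where "G = (\<lambda>y\<in>cube N. T y 1)"
  have G: "scalar_fcnn \<sigma> N (cube N) G" unfolding scalar_fcnn_def G_def using T(1) by blast
  have Gc: "G \<in> cfun (cube N)"
    unfolding G_def by (intro restrict_cfun continuous_on_subset[OF T(2)]) simp
  have "\<forall>y\<in>cube N. \<bar>X y - G y\<bar> < \<delta>" using T(3) by (simp add: G_def)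
  then have bound: "\<forall>y\<in>cube N. \<bar>X y - fold (\<lambda>n. mode_op N n (F n)) [1..<Suc N] G y\<bar> < \<epsilon>/2"
    using fold Gc by blast
  \<comment> \<open>A supremum is bounded by pointwise bounds only over a nonempty set.\<close>
  have "(\<lambda>i\<in>{1..N}. 0) \<in> cube N" by (auto simp: cube_def)
  then have "cube N \<noteq> {}" by blast
  then have "sup_norm (cube N) (\<lambda>y. X y - fold (\<lambda>n. mode_op N n (F n)) [1..<Suc N] G y) \<le> \<epsilon>/2"
    unfolding sup_norm_def using bound by (intro cSUP_least) (auto intro: less_imp_le)
  then have "sup_norm (cube N) (\<lambda>y. X y - fold (\<lambda>n. mode_op N n (F n)) [1..<Suc N] G y) < \<epsilon>"
    using \<open>\<epsilon> > 0\<close> by linarith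
  moreover have "\<forall>n\<in>{1..N}. deeponet \<sigma> (F n)" using F by auto
  ultimately show ?thesis using G Gc by blast
qed

end
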